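(* Let $\Lambda$, $\gamma_i(n)$, the arrays $\mathrm B,\Theta,\mathrm E,\mathrm T$ and the generator $\mathbf R$ be as in the context, and fix $M,N\in\mathbb Z_+$. The continuous-time Markov process on $\{(\underline y,\underline n)\in\mathbb Z_+^\Lambda\times\mathbb Z_+^\Lambda:\ |\underline y|=M,\ |\underline n|=N\}$ with generator $\mathbf R$ is positive recurrent and reversible. Its stationary probabilities are $$\pi(\underline y,\underline n)=\frac{\mathbf 1(|\underline y|=M,\ |\underline n|=N)}{\Xi_{N,\Lambda,M}}\prod_{j\in\Lambda}[\overline\gamma_j(n_j)]^{y_j},\qquad \Xi_{N,\Lambda,M}=\sum_{\substack{\underline y,\underline n\in\mathbb Z_+^\Lambda:\\ |\underline y|=M,\ |\underline n|=N}}\ \prod_{l\in\Lambda}[\overline\gamma_l(n_l)]^{y_l}.$$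
   Context: $\Lambda$ is a finite set of sites and $\mathbb Z_+=\{0,1,2,\dots\}$. A state is $(\underline y,\underline n)$ with $\underline y=(y_s)_{s\in\Lambda}\in\mathbb Z_+^\Lambda$ (numbers of distinguished customers at the sites) and $\underline n=(n_i)_{i\in\Lambda}\in\mathbb Z_+^\Lambda$ (numbers of tasks). $|\underline y|=\sum_sy_s$, $|\underline n|=\sum_sn_s$; write $j\in\underline y$ if $y_j\ge1$ and $l\notin\underline y$ if $y_l=0$. $\underline e^i$ is the unit vector at $i$, $\underline e^{i\to k}=\underline e^k-\underline e^i$, and $\mathbf 1$ is the indicator. The values $\gamma_i(n)\ge0$, $i\in\Lambda$, $n\in\mathbb Z_+$, satisfy $\gamma_i(0)=1$ and $\gamma_i(n)>0$ whenever $\gamma_i(n+1)>0$. Set $\overline\gamma_i(0)=1$, $\overline\gamma_i(n)=\prod_{0\le m<n}\gamma_i(m)$ for $n\ge1$. It is understood that $\overline\gamma_j(n_j)>0$ wherever its reciprocal appears below. The collections $\mathrm B(\underline n;\underline y)=(\beta_{kl}(n_k,n_l;\underline y))$, $\Theta(\underline n;\underline y)=(\theta_{kl}(n_k,n_l;\underline y))$, $\mathrm E(\underline n;\underline y)=(\epsilon_{ij}(n_i,n_j;\underline y))$, $\mathrm T(\underline n;\underline y)=(\tau_{jj'}(\underline n;\underline y))$ are irreducible, meaning that their off-diagonal entries are strictly positive. They satisfy: $$\beta_{kl}(n_k,n_l;\underline y)=\beta_{lk}(n_l+1,n_k-1;\underline y),\quad k\ne l,\ k,l\notin\underline y,\ n_k\ge1;$$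 $$\theta_{jk}(n_j,n_k;\underline y)=\theta_{kj}(n_k+1,n_j-1;\underline y),\quad j\in\underline y,\ k\notin\underline y,\ n_j\ge1;$$ $$\epsilon_{ij}(n_i,n_j;\underline y)[\gamma_i(n_i-1)]^{y_i}=[\gamma_j(n_j)]^{y_j}\epsilon_{ji}(n_j+1,n_i-1;\underline y),\quad i\ne j,\ i,j\in\underline y,\ n_i\ge1;$$ $$\tau_{jj'}(\underline n;\underline y)=\tau_{j'j}(\underline n;\underline y-\underline e^j+\underline e^{j'}),\quad j\in\underline y,\ j'\ne j.$$ The generator $\mathbf R$ has the following off-diagonal entries (all others are zero): - $R[(\underline y,\underline n);(\underline y,\underline n+\underline e^{k\to l})]=\beta_{kl}(n_k,n_l;\underline y)\mathbf 1(n_k\ge1)$, $k\ne l$, $k,l\notin\underline y$; - $R[(\underline y,\underline n);(\underline y,\underline n+\underline e^{i\to j})]=\epsilon_{ij}(n_i,n_j;\underline y)\mathbf 1(n_i\ge1)$, $i\ne j$, $i,j\in\underline y$; - $R[(\underline y,\underline n);(\underline y,\underline n+\underline e^{j\to l})]=\theta_{jl}(n_j,n_l;\underline y)\mathbf 1(n_j\ge1)$, $j\in\underline y$, $l\notin\underline y$; - $R[(\underline y,\underline n);(\underline y,\underline n+\underline e^{k\to j})]=\theta_{kj}(n_k,n_j;\underline y)[\gamma_j(n_j)]^{y_j}\mathbf 1(n_k\ge1)$, $j\in\underline y$, $k\notin\underline y$; - $R[(\underline y,\underline n);(\underline y+\underline e^{j\to j'},\underline n)]=[\overline\gamma_j(n_j)]^{-y_j}\,\tau_{jj'}(\underline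 n;\underline y)\,[\overline\gamma_{j'}(n_{j'})]^{-y_{j'}}$, $j\in\underline y$, $j'\ne j$. *)

theory Defs
  imports "HOL-Probability.Probability"
begin

definition generator_of_rates :: "'a set \<Rightarrow> ('a \<Rightarrow> 'a \<Rightarrow> real) \<Rightarrow> 'a \<Rightarrow> 'a \<Rightarrow> real" where
  "generator_of_rates S R x y = (if x = y then - (\<Sum>z\<in>S - {x}. R x z) else R x y)"

definition transition_prob ::
    "('a \<Rightarrow> 'w measure) \<Rightarrow> (real \<Rightarrow> 'w \<Rightarrow> 'a) \<Rightarrow> real \<Rightarrow> 'a \<Rightarrow> 'a \<Rightarrow> real" where
  "transition_prob Pr X t x y = measure (Pr x) {\<omega> \<in> space (Pr x). X t \<omega> = y}"

text \<open>
  A time-homogeneous Markov process \<open>(X t)\<close>, \<open>t \<ge> 0\<close>, with values in the finite set \<open>S\<close> and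
  generator \<open>Q\<close>, given by its family of laws: \<open>Pr x\<close> is the law of the process started at \<open>x\<close>.
  All \<open>Pr x\<close> live on the measurable space \<open>\<Omega>\<close>. Paths are right-continuous for the discrete
  topology of \<open>S\<close>, and the generator is the right derivative at time 0 of the transition function.
\<close>

locale markov_process =
  fixes \<Omega> :: "'w measure" and S :: "'a set" and Q :: "'a \<Rightarrow> 'a \<Rightarrow> real"
    and Pr :: "'a \<Rightarrow> 'w measure" and X :: "real \<Rightarrow> 'w \<Rightarrow> 'a"
  assumes finite_states: "finite S"
    and prob_space_Pr: "\<And>x. x \<in> S \<Longrightarrow> prob_space (Pr x)"
    and sets_Pr: "\<And>x. x \<in> S \<Longrightarrow> sets (Pr x) = sets \<Omega>"
    and measurable_X: "\<And>t. 0 \<le> t \<Longrightarrow> X t \<in> measurable \<Omega> (count_space S)"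
    and right_continuous:
      "\<And>t \<omega>. 0 \<le> t \<Longrightarrow> \<omega> \<in> space \<Omega> \<Longrightarrow> eventually (\<lambda>s. X s \<omega> = X t \<omega>) (at_right t)"
    and start: "\<And>x. x \<in> S \<Longrightarrow> measure (Pr x) {\<omega> \<in> space (Pr x). X 0 \<omega> = x} = 1"
    and markov_property:
      "\<And>x m t z. x \<in> S \<Longrightarrow> 0 \<le> t 0 \<Longrightarrow> (\<And>i. i \<le> m \<Longrightarrow> t i < t (Suc i)) \<Longrightarrow>
         (\<And>i. i \<le> Suc m \<Longrightarrow> z i \<in> S) \<Longrightarrow>
         measure (Pr x) {\<omega> \<in> space (Pr x). \<forall>i\<le>Suc m. X (t i) \<omega> = z i} =
         measure (Pr x) {\<omega> \<in> space (Pr x). \<forall>i\<le>m. X (t i) \<omega> = z i} *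
           transition_prob Pr X (t (Suc m) - t m) (z m) (z (Suc m))"
    and generator:
      "\<And>x y. x \<in> S \<Longrightarrow> y \<in> S \<Longrightarrow>
         ((\<lambda>t. transition_prob Pr X t x y) has_real_derivative Q x y) (at 0 within {0..})"

text \<open>
  The first time at which a path started at \<open>x\<close> is back at \<open>x\<close> after having left it;
  it is \<open>\<infinity>\<close> (the infimum of the empty set) if there is no such time.
\<close>

definition return_time :: "(real \<Rightarrow> 'w \<Rightarrow> 'a) \<Rightarrow> 'a \<Rightarrow> 'w \<Rightarrow> ennreal" where
  "return_time X x \<omega> =
     Inf {ennreal t | t. X t \<omega> = x \<and> (\<exists>s. 0 \<le> s \<and> s < t \<and> X s \<omega> \<noteq> x)}"

text \<open>As usual in continuous time, an absorbing state counts as positive recurrent.\<close>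

definition positive_recurrent ::
    "'a set \<Rightarrow> ('a \<Rightarrow> 'a \<Rightarrow> real) \<Rightarrow> ('a \<Rightarrow> 'w measure) \<Rightarrow> (real \<Rightarrow> 'w \<Rightarrow> 'a) \<Rightarrow> bool" where
  "positive_recurrent S Q Pr X \<longleftrightarrow>
     (\<forall>x\<in>S. Q x x = 0 \<or> (\<integral>\<^sup>+ \<omega>. return_time X x \<omega> \<partial>Pr x) < \<infinity>)"

definition stationary_distribution ::
    "'a set \<Rightarrow> ('a \<Rightarrow> 'w measure) \<Rightarrow> (real \<Rightarrow> 'w \<Rightarrow> 'a) \<Rightarrow> ('a \<Rightarrow> real) \<Rightarrow> bool" where
  "stationary_distribution S Pr X \<mu> \<longleftrightarrow>
     (\<forall>x. 0 \<le> \<mu> x) \<and> (\<forall>x. x \<notin> S \<longrightarrow> \<mu> x = 0) \<and> (\<Sum>x\<in>S. \<mu> x) = 1 \<and>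
     (\<forall>t\<ge>0. \<forall>y\<in>S. (\<Sum>x\<in>S. \<mu> x * transition_prob Pr X t x y) = \<mu> y)"

text \<open>
  Reversibility of the process with initial distribution \<open>\<mu>\<close>, whose law is the mixture
  \<open>\<Sum>x\<in>S. \<mu> x * Pr x\<close>: for all times in an interval \<open>{0..T}\<close>, the vectors
  \<open>(X (t 0), \<dots>, X (t (m - 1)))\<close> and \<open>(X (T - t 0), \<dots>, X (T - t (m - 1)))\<close> have the same law.
\<close>

definition reversible ::
    "'a set \<Rightarrow> ('a \<Rightarrow> 'w measure) \<Rightarrow> (real \<Rightarrow> 'w \<Rightarrow> 'a) \<Rightarrow> ('a \<Rightarrow> real) \<Rightarrow> bool" where
  "reversible S Pr X \<mu> \<longleftrightarrow>
     (\<forall>T (m::nat) t z. (\<forall>i<m. 0 \<le> t i \<and> t i \<le> T) \<longrightarrow>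
        (\<Sum>x\<in>S. \<mu> x * measure (Pr x) {\<omega> \<in> space (Pr x). \<forall>i<m. X (t i) \<omega> = z i}) =
        (\<Sum>x\<in>S. \<mu> x * measure (Pr x) {\<omega> \<in> space (Pr x). \<forall>i<m. X (T - t i) \<omega> = z i}))"

text \<open>The set of sites is a finite type \<open>'s\<close>; a state is a pair \<open>(y, n)\<close>.\<close>

type_synonym 's state = "('s \<Rightarrow> nat) \<times> ('s \<Rightarrow> nat)"

definition states :: "nat \<Rightarrow> nat \<Rightarrow> ('s::finite) state set" where
  "states M N = {(y, n). (\<Sum>s\<in>UNIV. y s) = M \<and> (\<Sum>s\<in>UNIV. n s) = N}"

text \<open>\<open>move k l n\<close> is \<open>n - e\<^sup>k + e\<^sup>l\<close>; it is used only for \<open>k \<noteq> l\<close> and \<open>n k \<ge> 1\<close>.\<close>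

definition move :: "'s \<Rightarrow> 's \<Rightarrow> ('s \<Rightarrow> nat) \<Rightarrow> 's \<Rightarrow> nat" where
  "move k l n = n(k := n k - 1, l := n l + 1)"

definition gamma_bar :: "('s \<Rightarrow> nat \<Rightarrow> real) \<Rightarrow> 's \<Rightarrow> nat \<Rightarrow> real" where
  "gamma_bar \<gamma> i n = (\<Prod>m<n. \<gamma> i m)"

type_synonym 's task_array = "'s \<Rightarrow> 's \<Rightarrow> nat \<Rightarrow> nat \<Rightarrow> ('s \<Rightarrow> nat) \<Rightarrow> real"
type_synonym 's customer_array = "'s \<Rightarrow> 's \<Rightarrow> ('s \<Rightarrow> nat) \<Rightarrow> ('s \<Rightarrow> nat) \<Rightarrow> real"

text \<open>
  The arguments of \<open>\<beta>\<close>, \<open>\<theta>\<close>, \<open>\<epsilon>\<close> are \<open>k l n\<^sub>k n\<^sub>l y\<close>, those of \<open>\<tau>\<close> are \<open>j j' n y\<close>.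
\<close>

definition task_rate ::
    "('s \<Rightarrow> nat \<Rightarrow> real) \<Rightarrow> 's task_array \<Rightarrow> 's task_array \<Rightarrow> 's task_array
     \<Rightarrow> ('s \<Rightarrow> nat) \<Rightarrow> ('s \<Rightarrow> nat) \<Rightarrow> 's \<Rightarrow> 's \<Rightarrow> real" where
  "task_rate \<gamma> \<beta> \<theta> \<epsilon> y n k l =
     (if y k = 0 \<and> y l = 0 then \<beta> k l (n k) (n l) y
      else if 1 \<le> y k \<and> 1 \<le> y l then \<epsilon> k l (n k) (n l) y
      else if 1 \<le> y k then \<theta> k l (n k) (n l) y
      else \<theta> k l (n k) (n l) y * \<gamma> l (n l) ^ y l)"

definition customer_rate ::
    "('s \<Rightarrow> nat \<Rightarrow> real) \<Rightarrow> 's customer_array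
     \<Rightarrow> ('s \<Rightarrow> nat) \<Rightarrow> ('s \<Rightarrow> nat) \<Rightarrow> 's \<Rightarrow> 's \<Rightarrow> real" where
  "customer_rate \<gamma> \<tau> y n j j' =
     inverse (gamma_bar \<gamma> j (n j) ^ y j) * \<tau> j j' n y * inverse (gamma_bar \<gamma> j' (n j') ^ y j')"

text \<open>
  The off-diagonal entries of the generator. For given states at most one summand is nonzero,
  as a nontrivial move determines its source, its target and the kind of particle moved.
\<close>

definition rate ::
    "(('s::finite) \<Rightarrow> nat \<Rightarrow> real) \<Rightarrow> 's task_array \<Rightarrow> 's task_array \<Rightarrow> 's task_array
     \<Rightarrow> 's customer_array \<Rightarrow> 's state \<Rightarrow> 's state \<Rightarrow> real" where
  "rate \<gamma> \<beta> \<theta> \<epsilon> \<tau> = (\<lambda>(y, n) s'.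
     (\<Sum>k\<in>UNIV. \<Sum>l\<in>UNIV - {k}.
        if 1 \<le> n k \<and> s' = (y, move k l n) then task_rate \<gamma> \<beta> \<theta> \<epsilon> y n k l else 0) +
     (\<Sum>j\<in>UNIV. \<Sum>j'\<in>UNIV - {j}.
        if 1 \<le> y j \<and> s' = (move j j' y, n) then customer_rate \<gamma> \<tau> y n j j' else 0))"

definition network_generator ::
    "nat \<Rightarrow> nat \<Rightarrow> (('s::finite) \<Rightarrow> nat \<Rightarrow> real)
     \<Rightarrow> 's task_array \<Rightarrow> 's task_array \<Rightarrow> 's task_array
     \<Rightarrow> 's customer_array \<Rightarrow> 's state \<Rightarrow> 's state \<Rightarrow> real" where
  "network_generator M N \<gamma> \<beta> \<theta> \<epsilon> \<tau> = generator_of_rates (states M N) (rate \<gamma> \<beta> \<theta> \<epsilon> \<tau>)"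

definition weight :: "(('s::finite) \<Rightarrow> nat \<Rightarrow> real) \<Rightarrow> 's state \<Rightarrow> real" where
  "weight \<gamma> = (\<lambda>(y, n). \<Prod>j\<in>UNIV. gamma_bar \<gamma> j (n j) ^ y j)"

definition partition_function :: "nat \<Rightarrow> nat \<Rightarrow> (('s::finite) \<Rightarrow> nat \<Rightarrow> real) \<Rightarrow> real" where
  "partition_function M N \<gamma> = (\<Sum>s\<in>states M N. weight \<gamma> s)"

definition equilibrium :: "nat \<Rightarrow> nat \<Rightarrow> (('s::finite) \<Rightarrow> nat \<Rightarrow> real) \<Rightarrow> 's state \<Rightarrow> real" where
  "equilibrium M N \<gamma> s = of_bool (s \<in> states M N) / partition_function M N \<gamma> * weight \<gamma> s"

end

theory Submission
  imports Defs
begin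

text \<open>
  The weights \<open>\<Prod>j. gamma_bar j (n j) ^ y j\<close> are in detailed balance with the rates. For a finite
  chain this passes from the generator \<open>Q\<close> to the transition function \<open>P\<close> without solving the
  Kolmogorov equations: the function \<open>G s = \<Sum>z. P s x z * P (t - s) y z / \<mu> z\<close> changes by \<open>o(h)\<close>
  on every interval of length \<open>h\<close>, hence is constant, and \<open>G 0 = G t\<close> is detailed balance of \<open>P t\<close>.
  Reversibility and stationarity follow. As every move has a positive rate, some \<open>P h\<close> is strictly
  positive, which gives uniqueness and a geometric bound on the return times along the
  skeleton \<open>h, 2 h, 3 h, \<dots>\<close>.
\<close>

text \<open>The locale gives \<open>Q\<close> only as the right derivative of \<open>P\<close> at
  time 0, besides the finite-dimensional laws. Hence \<open>G\<close> is not differentiated but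
  telescoped over n equal steps of length t / n, with total error n * o(t / n). In matrix form, with
  D = diag(\<mu>), \<open>G s\<close> is an entry of P_s D^-1 P_{t-s}^T, which joins D^-1 P_t^T at s
  = 0 to P_t D^-1 at s = t; formally its derivative contains the factor Q D^-1 - D^-1 Q^T, and this
  vanishes by detailed balance of the generator. A task that moves from k to l multiplies the weight
  by \<open>\<gamma> l (n l) ^ y l / \<gamma> k (n k - 1) ^ y k\<close>; the powers of \<gamma> in
  the rates and in the symmetry of \<epsilon> compensate this ratio. Sampling the path at the times
  of a skeleton keeps the return time estimate within finite-dimensional laws, without stopping
  times or the jump chain.\<close>

context markov_process
begin

section \<open>Transition function and finite-dimensional laws\<close>

abbreviation P :: "real \<Rightarrow> 'a \<Rightarrow> 'a \<Rightarrow> real" where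
  "P \<equiv> transition_prob Pr X"

lemma space_Pr: "x \<in> S \<Longrightarrow> space (Pr x) = space \<Omega>"
  by (rule sets_eq_imp_space_eq) (rule sets_Pr)

lemma X_in_S:
  assumes "x \<in> S" "0 \<le> t" "\<omega> \<in> space (Pr x)"
  shows "X t \<omega> \<in> S"
  using measurable_space[OF measurable_X[OF assms(2)], of \<omega>] assms(1,3) by (simp add: space_Pr)

lemma sets_X_eq:
  assumes "x \<in> S" "0 \<le> t"
  shows "{\<omega> \<in> space (Pr x). X t \<omega> = y} \<in> sets (Pr x)"
proof -
  have "X t -` ({y} \<inter> S) \<inter> space \<Omega> \<in> sets \<Omega>"
    by (rule measurable_sets[OF measurable_X[OF assms(2)]]) auto
  moreover have "X t -` ({y} \<inter> S) \<inter> space \<Omega> = {\<omega> \<in> space (Pr x). X t \<omega> = y}"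
    using X_in_S[OF assms] space_Pr[OF assms(1)] by auto
  ultimately show ?thesis
    using sets_Pr[OF assms(1)] by simp
qed

lemma sets_cylinder:
  assumes "x \<in> S" "finite I" "\<And>i. i \<in> I \<Longrightarrow> 0 \<le> t i"
  shows "{\<omega> \<in> space (Pr x). \<forall>i\<in>I. X (t i) \<omega> = z i} \<in> sets (Pr x)"
  using assms by (intro sets.sets_Collect_finite_All sets_X_eq) auto

lemma P_nonneg: "0 \<le> P t x y"
  by (simp add: transition_prob_def)

lemma P_le_1: "x \<in> S \<Longrightarrow> P t x y \<le> 1"
  by (simp add: transition_prob_def prob_space.prob_le_1 prob_space_Pr)

lemma measure_sum_X:
  assumes "x \<in> S" "0 \<le> t" "A \<in> sets (Pr x)"
  shows "measure (Pr x) A = (\<Sum>y\<in>S. measure (Pr x) {\<omega> \<in> A. X t \<omega> = y})"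
proof -
  interpret prob_space "Pr x" by (rule prob_space_Pr[OF assms(1)])
  have A: "A \<subseteq> space (Pr x)"
    using assms(3) sets.sets_into_space by blast
  have "measure (Pr x) A = measure (Pr x) (\<Union>y\<in>S. {\<omega> \<in> A. X t \<omega> = y})"
    using X_in_S[OF assms(1,2)] A by (intro arg_cong[of _ _ "measure (Pr x)"]) auto
  also have "\<dots> = (\<Sum>y\<in>S. measure (Pr x) {\<omega> \<in> A. X t \<omega> = y})"
  proof (rule finite_measure_finite_Union[OF finite_states])
    show "(\<lambda>y. {\<omega> \<in> A. X t \<omega> = y}) ` S \<subseteq> sets (Pr x)"
    proof clarify
      fix y assume "y \<in> S"
      have "{\<omega> \<in> A. X t \<omega> = y} = A \<inter> {\<omega> \<in> space (Pr x). X t \<omega> = y}"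
        using A by auto
      then show "{\<omega> \<in> A. X t \<omega> = y} \<in> sets (Pr x)"
        using sets_X_eq[OF assms(1,2)] assms(3) by auto
    qed
  qed (auto simp: disjoint_family_on_def)
  finally show ?thesis .
qed

lemma sum_P:
  assumes "x \<in> S" "0 \<le> t"
  shows "(\<Sum>y\<in>S. P t x y) = 1"
  using measure_sum_X[OF assms sets.top] prob_space.prob_space[OF prob_space_Pr[OF assms(1)]]
  by (simp add: transition_prob_def)

lemma P_0:
  assumes "x \<in> S" "y \<in> S"
  shows "P 0 x y = of_bool (x = y)"
proof (cases "x = y")
  case True
  then show ?thesis using start[OF assms(1)] by (simp add: transition_prob_def)
next
  case False
  have "P 0 x x + P 0 x y = (\<Sum>z\<in>{x, y}. P 0 x z)"
    using False by simp
  also have "\<dots> \<le> (\<Sum>z\<in>S. P 0 x z)"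
    using assms finite_states by (intro sum_mono2) (auto simp: P_nonneg)
  also have "\<dots> = 1"
    by (rule sum_P) (use assms in auto)
  finally show ?thesis
    using False start[OF assms(1)] P_nonneg[of 0 x y] by (simp add: transition_prob_def order_antisym)
qed

lemma chapman_kolmogorov:
  assumes "x \<in> S" "y \<in> S" "0 \<le> s" "0 \<le> t"
  shows "P (s + t) x y = (\<Sum>z\<in>S. P s x z * P t z y)"
proof (cases "t = 0")
  \<comment> \<open>The Markov property is stated for strictly increasing times, so a step of length
    0 is handled through \<open>P_0\<close>.\<close>
  case True
  have "(\<Sum>z\<in>S. P s x z * P t z y) = (\<Sum>z\<in>S. if y = z then P s x z else 0)"
    using assms True by (intro sum.cong) (auto simp: P_0)
  then show ?thesis
    using True assms finite_states by (simp add: sum.delta')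
next
  case False
  have *: "measure (Pr x) {\<omega> \<in> {\<omega> \<in> space (Pr x). X (s + t) \<omega> = y}. X s \<omega> = z} = P s x z * P t z y"
    if "z \<in> S" for z
  proof -
    define u where "u = (\<lambda>i::nat. if i = 0 then s else s + t)"
    define v where "v = (\<lambda>i::nat. if i = 0 then z else y)"
    have "measure (Pr x) {\<omega> \<in> space (Pr x). \<forall>i\<le>Suc 0. X (u i) \<omega> = v i} =
         measure (Pr x) {\<omega> \<in> space (Pr x). \<forall>i\<le>0. X (u i) \<omega> = v i} *
           P (u (Suc 0) - u 0) (v 0) (v (Suc 0))"
      by (rule markov_property[of x u 0 v]) (use assms False that in \<open>auto simp: u_def v_def\<close>)
    moreover have "{\<omega> \<in> space (Pr x). \<forall>i\<le>Suc 0. X (u i) \<omega> = v i} =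
        {\<omega> \<in> {\<omega> \<in> space (Pr x). X (s + t) \<omega> = y}. X s \<omega> = z}"
      by (auto simp: u_def v_def le_Suc_eq)
    ultimately show ?thesis
      by (simp add: u_def v_def transition_prob_def)
  qed
  have "P (s + t) x y = measure (Pr x) {\<omega> \<in> space (Pr x). X (s + t) \<omega> = y}"
    by (simp add: transition_prob_def)
  also have "\<dots> = (\<Sum>z\<in>S. P s x z * P t z y)"
    using assms * by (subst measure_sum_X[OF assms(1,3) sets_X_eq]) simp_all
  finally show ?thesis .
qed

lemma chapman_kolmogorov_ge:
  assumes "x \<in> S" "y \<in> S" "z \<in> S" "0 \<le> s" "0 \<le> t"
  shows "P s x z * P t z y \<le> P (s + t) x y"
  unfolding chapman_kolmogorov[OF assms(1,2,4,5)]
  using assms finite_states by (intro member_le_sum[where f = "\<lambda>z. P s x z * P t z y"]) (auto simp: P_nonneg)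

lemma finite_dimensional:
  assumes "x \<in> S" "0 \<le> t 0" "\<And>i. i < m \<Longrightarrow> t i < t (Suc i)" "\<And>i. i \<le> m \<Longrightarrow> z i \<in> S"
  shows "measure (Pr x) {\<omega> \<in> space (Pr x). \<forall>i\<le>m. X (t i) \<omega> = z i} =
    P (t 0) x (z 0) * (\<Prod>i<m. P (t (Suc i) - t i) (z i) (z (Suc i)))"
  using assms(3,4)
proof (induction m)
  case 0
  then show ?case by (simp add: transition_prob_def)
next
  case (Suc m)
  have "measure (Pr x) {\<omega> \<in> space (Pr x). \<forall>i\<le>Suc m. X (t i) \<omega> = z i} =
      measure (Pr x) {\<omega> \<in> space (Pr x). \<forall>i\<le>m. X (t i) \<omega> = z i} *
        P (t (Suc m) - t m) (z m) (z (Suc m))"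
    by (rule markov_property[of x t m z]) (use assms(1,2) Suc.prems in auto)
  also have "measure (Pr x) {\<omega> \<in> space (Pr x). \<forall>i\<le>m. X (t i) \<omega> = z i} =
      P (t 0) x (z 0) * (\<Prod>i<m. P (t (Suc i) - t i) (z i) (z (Suc i)))"
    by (rule Suc.IH) (use Suc.prems in auto)
  finally show ?case
    by simp
qed

text \<open>The Markov property of the locale prescribes the whole past. An event \<open>A\<close>
  that depends on the first \<open>Suc m\<close> samples is a finite disjoint union of such
  cylinders; all of them end in \<open>b\<close>, so they share one transition factor. This form is
  needed for the event that a return has not yet been observed.\<close>

lemma markov_past:
  assumes x: "x \<in> S" and t: "0 \<le> t 0" "\<And>i. i \<le> m \<Longrightarrow> t i < t (Suc i)" and c: "c \<in> S"
    and past: "\<And>f g. (\<And>i. i \<le> m \<Longrightarrow> f i = g i) \<Longrightarrow> A f = A g"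
    and present: "\<And>f. A f \<Longrightarrow> f m = b"
  shows "measure (Pr x) {\<omega> \<in> space (Pr x). A (\<lambda>i. X (t i) \<omega>) \<and> X (t (Suc m)) \<omega> = c} =
    measure (Pr x) {\<omega> \<in> space (Pr x). A (\<lambda>i. X (t i) \<omega>)} * P (t (Suc m) - t m) b c"
proof -
  interpret prob_space "Pr x" by (rule prob_space_Pr[OF x])
  have t_nonneg: "0 \<le> t i" if "i \<le> Suc m" for i
    using that
  proof (induction i)
    case (Suc i)
    then show ?case using t(2)[of i] by simp
  qed (simp add: t)
  \<comment> \<open>Extensional functions represent each past exactly once; this makes
    \<open>F\<close> finite and the cylinders \<open>C f\<close> disjoint.\<close>
  define F where "F = {f \<in> {..m} \<rightarrow>\<^sub>E S. A f}"
  define C where "C f = {\<omega> \<in> space (Pr x). \<forall>i\<le>m. X (t i) \<omega> = f i}" for f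
  define D where "D f = {\<omega> \<in> space (Pr x). \<forall>i\<le>Suc m. X (t i) \<omega> = (f(Suc m := c)) i}" for f
  have fin: "finite F"
    unfolding F_def using finite_states by (intro finite_subset[OF _ finite_PiE[of "{..m}" "\<lambda>_. S"]]) auto
  have CU: "{\<omega> \<in> space (Pr x). A (\<lambda>i. X (t i) \<omega>)} = (\<Union>f\<in>F. C f)"
  proof (intro equalityI subsetI)
    fix \<omega> assume \<omega>: "\<omega> \<in> {\<omega> \<in> space (Pr x). A (\<lambda>i. X (t i) \<omega>)}"
    define f where "f = restrict (\<lambda>i. X (t i) \<omega>) {..m}"
    have "A f = A (\<lambda>i. X (t i) \<omega>)"
      by (rule past) (simp add: f_def)
    moreover have "f \<in> {..m} \<rightarrow>\<^sub>E S"
      using \<omega> t_nonneg by (auto simp: f_def intro!: X_in_S[OF x])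
    ultimately show "\<omega> \<in> (\<Union>f\<in>F. C f)"
      using \<omega> by (intro UN_I[of f]) (auto simp: F_def C_def f_def)
  next
    fix \<omega> assume "\<omega> \<in> (\<Union>f\<in>F. C f)"
    then obtain f where f: "A f" "\<omega> \<in> space (Pr x)" "\<forall>i\<le>m. X (t i) \<omega> = f i"
      by (auto simp: F_def C_def)
    have "A f = A (\<lambda>i. X (t i) \<omega>)"
      by (rule past) (simp add: f(3))
    then show "\<omega> \<in> {\<omega> \<in> space (Pr x). A (\<lambda>i. X (t i) \<omega>)}"
      using f(1,2) by simp
  qed
  have DC: "D f = C f \<inter> {\<omega> \<in> space (Pr x). X (t (Suc m)) \<omega> = c}" for f
    by (auto simp: C_def D_def le_Suc_eq)
  have DU: "{\<omega> \<in> space (Pr x). A (\<lambda>i. X (t i) \<omega>) \<and> X (t (Suc m)) \<omega> = c} = (\<Union>f\<in>F. D f)"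
  proof -
    have "{\<omega> \<in> space (Pr x). A (\<lambda>i. X (t i) \<omega>) \<and> X (t (Suc m)) \<omega> = c} =
        {\<omega> \<in> space (Pr x). A (\<lambda>i. X (t i) \<omega>)} \<inter> {\<omega> \<in> space (Pr x). X (t (Suc m)) \<omega> = c}"
      by auto
    then show ?thesis
      unfolding CU DC by blast
  qed
  have Csets: "C f \<in> sets (Pr x)" for f
    unfolding C_def by (rule sets_cylinder[OF x, of "{..m}", unfolded Ball_def atMost_iff]) (auto intro: t_nonneg)
  have Dsets: "D f \<in> sets (Pr x)" for f
    unfolding DC by (intro sets.Int Csets sets_X_eq x t_nonneg) simp
  have Cdisj: "disjoint_family_on C F"
    unfolding disjoint_family_on_def
  proof (intro ballI impI)
    fix f g assume *: "f \<in> F" "g \<in> F" "f \<noteq> g"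
    then obtain i where "i \<le> m" "f i \<noteq> g i"
      using PiE_ext[of f "{..m}" "\<lambda>_. S" g] by (auto simp: F_def)
    then show "C f \<inter> C g = {}" by (auto simp: C_def)
  qed
  then have Ddisj: "disjoint_family_on D F"
    unfolding DC disjoint_family_on_def by blast
  have "measure (Pr x) (D f) = measure (Pr x) (C f) * P (t (Suc m) - t m) b c" if "f \<in> F" for f
  proof -
    have "f i \<in> S" if "i \<le> m" for i using \<open>f \<in> F\<close> that by (auto simp: F_def)
    moreover have "f m = b" using present[of f] that by (simp add: F_def)
    ultimately have "measure (Pr x) (D f) =
        measure (Pr x) {\<omega> \<in> space (Pr x). \<forall>i\<le>m. X (t i) \<omega> = (f(Suc m := c)) i} * P (t (Suc m) - t m) b c"
      using markov_property[of x t m "f(Suc m := c)"] x t c by (simp add: D_def)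
    also have "{\<omega> \<in> space (Pr x). \<forall>i\<le>m. X (t i) \<omega> = (f(Suc m := c)) i} = C f"
      by (auto simp: C_def)
    finally show ?thesis .
  qed
  then have "(\<Sum>f\<in>F. measure (Pr x) (D f)) = (\<Sum>f\<in>F. measure (Pr x) (C f)) * P (t (Suc m) - t m) b c"
    by (simp add: sum_distrib_right)
  moreover have "measure (Pr x) (\<Union>f\<in>F. C f) = (\<Sum>f\<in>F. measure (Pr x) (C f))"
    using fin Csets Cdisj by (intro finite_measure_finite_Union) auto
  moreover have "measure (Pr x) (\<Union>f\<in>F. D f) = (\<Sum>f\<in>F. measure (Pr x) (D f))"
    using fin Dsets Ddisj by (intro finite_measure_finite_Union) auto
  ultimately show ?thesis
    unfolding CU DU by simp
qed

section \<open>From detailed balance of the generator to detailed balance of the transition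
  function\<close>

lemma P_quotient_tendsto:
  assumes "x \<in> S" "y \<in> S"
  shows "((\<lambda>t. (P t x y - P 0 x y) / t) \<longlongrightarrow> Q x y) (at 0 within {0..})"
  using generator[OF assms] by (simp add: has_field_derivative_iff)

lemma P_detailed_balance:
  assumes pos: "\<And>x. x \<in> S \<Longrightarrow> 0 < \<mu> x"
    and balance: "\<And>x y. x \<in> S \<Longrightarrow> y \<in> S \<Longrightarrow> \<mu> x * Q x y = \<mu> y * Q y x"
    and x: "x \<in> S" and y: "y \<in> S" and t: "0 \<le> t"
  shows "\<mu> x * P t x y = \<mu> y * P t y x"
proof (cases "t = 0")
  case True
  then show ?thesis using x y by (simp add: P_0)
next
  case False
  then have "0 < t" using t by simp
  \<comment> \<open>\<open>b h\<close> is the defect of detailed balance over a time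
    \<open>h\<close>, divided by \<open>\<mu> w * \<mu> z\<close>; balance of \<open>Q\<close> makes
    it o(h).\<close>
  define b where "b h w z = P h w z / \<mu> z - P h z w / \<mu> w" for h w z
  define e where "e h = (\<Sum>w\<in>S. \<Sum>z\<in>S. \<bar>b h w z\<bar>)" for h
  define G where "G s = (\<Sum>z\<in>S. P s x z * P (t - s) y z / \<mu> z)" for s
  have "((\<lambda>h. b h w z / h) \<longlongrightarrow> 0) (at 0 within {0..})" if "w \<in> S" "z \<in> S" for w z
  proof -
    have "((\<lambda>h. (P h w z - P 0 w z) / h / \<mu> z - (P h z w - P 0 z w) / h / \<mu> w)
        \<longlongrightarrow> Q w z / \<mu> z - Q z w / \<mu> w) (at 0 within {0..})"
      using that by (intro tendsto_diff tendsto_divide P_quotient_tendsto tendsto_const) (auto dest: pos)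
    moreover have "Q w z / \<mu> z - Q z w / \<mu> w = 0"
      using balance[OF that] pos[of w] pos[of z] that by (simp add: field_simps)
    \<comment> \<open>The terms at time 0 cancel: off the diagonal both are 0, and on it both are
      \<open>1 / \<mu> w\<close>.\<close>
    moreover have "(P h w z - P 0 w z) / h / \<mu> z - (P h z w - P 0 z w) / h / \<mu> w = b h w z / h" for h
      using that by (auto simp: b_def P_0 diff_divide_distrib divide_divide_eq_left mult.commute)
    ultimately show ?thesis by simp
  qed
  then have "((\<lambda>h. \<Sum>w\<in>S. \<Sum>z\<in>S. \<bar>b h w z / h\<bar>) \<longlongrightarrow> (\<Sum>w\<in>S. \<Sum>z\<in>S. 0)) (at 0 within {0..})"
    by (intro tendsto_sum tendsto_rabs_zero)
  \<comment> \<open>With h = t / (n + 1), exactly n + 1 steps of length h lead from 0 to t.\<close>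
  moreover have "filterlim (\<lambda>n. t / real (Suc n)) (at 0 within {0..}) sequentially"
    unfolding filterlim_at using \<open>0 < t\<close> LIMSEQ_Suc[OF lim_const_over_n[of t]]
    by (auto intro!: always_eventually)
  ultimately have "(\<lambda>n. \<Sum>w\<in>S. \<Sum>z\<in>S. \<bar>b (t / real (Suc n)) w z / (t / real (Suc n))\<bar>) \<longlonglongrightarrow> 0"
    using filterlim_compose[of "\<lambda>h. \<Sum>w\<in>S. \<Sum>z\<in>S. \<bar>b h w z / h\<bar>"] by fastforce
  then have lim: "(\<lambda>n. t * (\<Sum>w\<in>S. \<Sum>z\<in>S. \<bar>b (t / real (Suc n)) w z / (t / real (Suc n))\<bar>)) \<longlonglongrightarrow> 0"
    by (rule tendsto_mult_right_zero)
  have step: "\<bar>G (s + h) - G s\<bar> \<le> e h" if "0 \<le> s" "0 \<le> h" "s + h \<le> t" for s h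
  proof -
    \<comment> \<open>Splitting \<open>P (s + h)\<close> in \<open>G (s + h)\<close> and
      \<open>P (t - s) = P (r + h)\<close> in \<open>G s\<close> gives two double sums with the same
      outer factors \<open>P s x w * P r y z\<close>; their difference has the kernel
      \<open>b h\<close>.\<close>
    define r where "r = t - (s + h)"
    have r: "0 \<le> r" "t - s = r + h" using that by (auto simp: r_def)
    have "G (s + h) = (\<Sum>z\<in>S. \<Sum>w\<in>S. P s x w * P h w z * P r y z / \<mu> z)"
      unfolding G_def r_def[symmetric] using that x
      by (intro sum.cong) (auto simp: chapman_kolmogorov sum_distrib_right sum_divide_distrib)
    also have "\<dots> = (\<Sum>w\<in>S. \<Sum>z\<in>S. P s x w * P h w z * P r y z / \<mu> z)"
      by (rule sum.swap)
    finally have G1: "G (s + h) = (\<Sum>w\<in>S. \<Sum>z\<in>S. P s x w * P h w z * P r y z / \<mu> z)" .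
    have G0: "G s = (\<Sum>w\<in>S. \<Sum>z\<in>S. P s x w * (P r y z * P h z w) / \<mu> w)"
      unfolding G_def r(2) using that r y
      by (intro sum.cong) (auto simp: chapman_kolmogorov sum_distrib_left sum_divide_distrib)
    have "G (s + h) - G s = (\<Sum>w\<in>S. \<Sum>z\<in>S. P s x w * P r y z * b h w z)"
      unfolding G0 G1 sum_subtractf[symmetric]
      by (intro sum.cong) (auto simp: b_def algebra_simps)
    also have "\<bar>\<dots>\<bar> \<le> e h"
      unfolding e_def
    proof (intro order_trans[OF sum_abs] sum_mono)
      fix w z assume "w \<in> S" "z \<in> S"
      have "P s x w * P r y z \<le> 1 * 1"
        using x y by (intro mult_mono P_le_1) (auto simp: P_nonneg)
      then show "\<bar>P s x w * P r y z * b h w z\<bar> \<le> \<bar>b h w z\<bar>"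
        by (simp add: abs_mult P_nonneg mult_left_le_one_le)
    qed
    finally show ?thesis .
  qed
  have steps: "\<bar>G (real n * h) - G 0\<bar> \<le> real n * e h" if "0 \<le> h" "real n * h \<le> t" for n h
    using that(2)
  proof (induction n)
    case (Suc n)
    have "real n * h \<le> t"
      using Suc.prems that(1) by (simp add: distrib_right)
    then have "\<bar>G (real n * h) - G 0\<bar> \<le> real n * e h"
      by (rule Suc.IH)
    moreover have "\<bar>G (real n * h + h) - G (real n * h)\<bar> \<le> e h"
      using Suc.prems that(1) by (intro step) (auto simp: algebra_simps)
    ultimately show ?case
      by (simp add: algebra_simps)
  qed simp
  have "\<bar>G t - G 0\<bar> \<le> t * (\<Sum>w\<in>S. \<Sum>z\<in>S. \<bar>b (t / real (Suc n)) w z / (t / real (Suc n))\<bar>)" for n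
  proof -
    define h where "h = t / real (Suc n)"
    have h: "0 < h" "real (Suc n) * h = t"
      using \<open>0 < t\<close> by (simp_all add: h_def)
    have "e h = h * (\<Sum>w\<in>S. \<Sum>z\<in>S. \<bar>b h w z / h\<bar>)"
      unfolding e_def sum_distrib_left using h(1) by (intro sum.cong) auto
    then have "real (Suc n) * e h = t * (\<Sum>w\<in>S. \<Sum>z\<in>S. \<bar>b h w z / h\<bar>)"
      by (simp only: mult.assoc[symmetric] h(2))
    moreover have "\<bar>G t - G 0\<bar> \<le> real (Suc n) * e h"
      using steps[of h "Suc n"] h(1) by (simp only: h(2))
    ultimately show ?thesis
      by (simp only: h_def)
  qed
  then have "\<bar>G t - G 0\<bar> \<le> 0"
    by (intro LIMSEQ_le_const[OF lim]) auto
  \<comment> \<open>At either end one factor of \<open>G\<close> is \<open>P 0\<close>, so a single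
    summand survives.\<close>
  moreover have "G t = (\<Sum>z\<in>S. if y = z then P t x y / \<mu> y else 0)"
    unfolding G_def using y by (intro sum.cong) (auto simp: P_0)
  then have "G t = P t x y / \<mu> y"
    using y finite_states by simp
  moreover have "G 0 = (\<Sum>z\<in>S. if x = z then P t y x / \<mu> x else 0)"
    unfolding G_def using x by (intro sum.cong) (auto simp: P_0)
  then have "G 0 = P t y x / \<mu> x"
    using x finite_states by simp
  ultimately show ?thesis
    using pos[OF x] pos[OF y] by (simp add: field_simps)
qed

section \<open>Strict positivity, stationary distributions and mean return times\<close>

text \<open>For some small \<open>t\<close>, \<open>P t\<close> is positive on the diagonal and on
  every edge of \<open>Q\<close>. A path of L edges then gives positivity at all times k t with k at
  least L, since waiting is possible; finitely many pairs have a common k.\<close>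

lemma P_positive:
  assumes irreducible:
    "\<And>x y. x \<in> S \<Longrightarrow> y \<in> S \<Longrightarrow> (x, y) \<in> {(x, y). x \<in> S \<and> y \<in> S \<and> x \<noteq> y \<and> 0 < Q x y}\<^sup>*"
  obtains h where "0 < h" "\<And>x y. x \<in> S \<Longrightarrow> y \<in> S \<Longrightarrow> 0 < P h x y"
proof -
  have "eventually (\<lambda>t. x = y \<or> 0 < Q x y \<longrightarrow> 0 < P t x y) (at_right 0)"
    if "x \<in> S" "y \<in> S" for x y
  proof (cases "x = y")
    case True
    have "((\<lambda>t. P t x y) \<longlongrightarrow> P 0 x y) (at 0 within {0..})"
      using has_field_derivative_imp_has_derivative[OF generator[OF that], THEN has_derivative_continuous]
      by (simp add: continuous_within)
    then have "((\<lambda>t. P t x y) \<longlongrightarrow> 1) (at_right 0)"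
      using True that by (auto simp: P_0 intro: tendsto_within_subset)
    then have "eventually (\<lambda>t. 0 < P t x y) (at_right 0)"
      by (rule order_tendstoD) simp
    then show ?thesis by eventually_elim simp
  next
    case False
    show ?thesis
    proof (cases "0 < Q x y")
      case True
      have "((\<lambda>t. P t x y / t) \<longlongrightarrow> Q x y) (at_right 0)"
        using P_quotient_tendsto[OF that] False that by (auto simp: P_0 intro: tendsto_within_subset)
      then have "eventually (\<lambda>t. 0 < P t x y / t) (at_right 0)"
        using True by (rule order_tendstoD)
      moreover have "eventually (\<lambda>t::real. 0 < t) (at_right 0)"
        by (rule eventually_at_right_less)
      ultimately show ?thesis
        by eventually_elim (simp add: zero_less_divide_iff)
    qed (use False in simp)
  qed
  then have "eventually (\<lambda>t. \<forall>x\<in>S. \<forall>y\<in>S. x = y \<or> 0 < Q x y \<longrightarrow> 0 < P t x y) (at_right 0)"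
    by (intro eventually_ball_finite finite_states ballI)
  then have "eventually (\<lambda>t. 0 < t \<and> (\<forall>x\<in>S. \<forall>y\<in>S. x = y \<or> 0 < Q x y \<longrightarrow> 0 < P t x y)) (at_right 0)"
    using eventually_at_right_less[of "0::real"] by eventually_elim simp
  then obtain t where t: "0 < t" "\<And>x y. x \<in> S \<Longrightarrow> y \<in> S \<Longrightarrow> x = y \<or> 0 < Q x y \<Longrightarrow> 0 < P t x y"
    using eventually_happens'[OF trivial_limit_at_right_real] by blast
  have diag: "0 < P (real k * t) x x" if "x \<in> S" for k x
  proof (induction k)
    case (Suc k)
    then have "0 < P (real k * t) x x * P t x x"
      using t(2) that by simp
    also have "\<dots> \<le> P (real k * t + t) x x"
      using that t(1) by (intro chapman_kolmogorov_ge) auto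
    finally show ?case by (simp add: algebra_simps)
  qed (use that in \<open>simp add: P_0\<close>)
  \<comment> \<open>Proving positivity for all large \<open>k\<close>, not just for some
    \<open>k\<close>, is what allows one \<open>k\<close> for all pairs.\<close>
  have "eventually (\<lambda>k. 0 < P (real k * t) x y) sequentially" if "x \<in> S" "y \<in> S" for x y
    using irreducible[OF that]
  proof (induction rule: rtrancl_induct)
    case base
    then show ?case using diag that by simp
  next
    case (step y z)
    then have yz: "y \<in> S" "z \<in> S" "0 < P t y z"
      using t(2) by auto
    have "eventually (\<lambda>k. 0 < P (real (Suc k) * t) x z) sequentially"
      using step.IH
    proof eventually_elim
      case (elim k)
      then have "0 < P (real k * t) x y * P t y z"
        using yz by simp
      also have "\<dots> \<le> P (real k * t + t) x z"
        using that yz t(1) by (intro chapman_kolmogorov_ge) auto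
      finally show ?case by (simp add: algebra_simps)
    qed
    then show ?case
      by (subst (asm) eventually_sequentially_Suc)
  qed
  then have "eventually (\<lambda>k. \<forall>x\<in>S. \<forall>y\<in>S. 0 < P (real k * t) x y) sequentially"
    by (intro eventually_ball_finite finite_states ballI)
  then have "eventually (\<lambda>k. 0 < k \<and> (\<forall>x\<in>S. \<forall>y\<in>S. 0 < P (real k * t) x y)) sequentially"
    using eventually_gt_at_top[of "0::nat"] by eventually_elim simp
  then obtain k where "0 < k" "\<forall>x\<in>S. \<forall>y\<in>S. 0 < P (real k * t) x y"
    using eventually_happens'[OF sequentially_bot] by blast
  then show ?thesis
    using t(1) by (intro that[of "real k * t"]) auto
qed

lemma stationary_if_reversible:
  assumes "\<And>x y. x \<in> S \<Longrightarrow> y \<in> S \<Longrightarrow> \<mu> x * P t x y = \<mu> y * P t y x" "0 \<le> t" "y \<in> S"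
  shows "(\<Sum>x\<in>S. \<mu> x * P t x y) = \<mu> y"
proof -
  have "(\<Sum>x\<in>S. \<mu> x * P t x y) = (\<Sum>x\<in>S. \<mu> y * P t y x)"
    using assms by (intro sum.cong) auto
  also have "\<dots> = \<mu> y"
    using sum_P[OF assms(3,2)] by (simp flip: sum_distrib_left)
  finally show ?thesis .
qed

text \<open>
  Subtracting from \<open>\<nu>\<close> the largest multiple of \<open>\<mu>\<close> below it leaves a nonnegative invariant
  vector with a zero entry; strict positivity of \<open>P h\<close> makes that vector zero.
\<close>

lemma stationary_distribution_unique:
  assumes h: "0 < h" "\<And>x y. x \<in> S \<Longrightarrow> y \<in> S \<Longrightarrow> 0 < P h x y"
    and pos: "\<And>x. x \<in> S \<Longrightarrow> 0 < \<mu> x"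
    and \<mu>: "stationary_distribution S Pr X \<mu>" and \<nu>: "stationary_distribution S Pr X \<nu>"
  shows "\<nu> = \<mu>"
proof -
  have "S \<noteq> {}"
    using \<mu> by (auto simp: stationary_distribution_def)
  define c where "c = Min ((\<lambda>x. \<nu> x / \<mu> x) ` S)"
  have "c \<in> (\<lambda>x. \<nu> x / \<mu> x) ` S"
    unfolding c_def using finite_states \<open>S \<noteq> {}\<close> by (intro Min_in) auto
  then obtain x0 where x0: "x0 \<in> S" "c = \<nu> x0 / \<mu> x0" by blast
  have le: "0 \<le> \<nu> x - c * \<mu> x" if "x \<in> S" for x
  proof -
    have "c \<le> \<nu> x / \<mu> x"
      unfolding c_def using finite_states that by (intro Min_le) auto
    then show ?thesis using pos[OF that] by (simp add: field_simps)
  qed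
  have "(\<Sum>x\<in>S. (\<nu> x - c * \<mu> x) * P h x x0) = (\<Sum>x\<in>S. \<nu> x * P h x x0) - c * (\<Sum>x\<in>S. \<mu> x * P h x x0)"
    by (simp add: sum_subtractf left_diff_distrib sum_distrib_left mult.assoc)
  also have "\<dots> = \<nu> x0 - c * \<mu> x0"
    using \<mu> \<nu> h(1) x0(1) by (auto simp: stationary_distribution_def)
  also have "\<dots> = 0"
    using x0 pos[of x0] by simp
  finally have "\<forall>x\<in>S. (\<nu> x - c * \<mu> x) * P h x x0 = 0"
    using le finite_states by (subst (asm) sum_nonneg_eq_0_iff) (auto simp: P_nonneg)
  then have eq: "\<nu> x = c * \<mu> x" if "x \<in> S" for x
    using h(2)[OF that x0(1)] that by auto
  then have "(\<Sum>x\<in>S. \<nu> x) = c * (\<Sum>x\<in>S. \<mu> x)"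
    by (simp add: sum_distrib_left)
  then have "c = 1"
    using \<mu> \<nu> by (simp add: stationary_distribution_def)
  show ?thesis
  proof
    fix x show "\<nu> x = \<mu> x"
      using eq[of x] \<open>c = 1\<close> \<mu> \<nu> by (cases "x \<in> S") (auto simp: stationary_distribution_def)
  qed
qed

text \<open>
  Whatever the state at time \<open>2 k h\<close>, the path visits \<open>a\<close> at time \<open>(2 k + 1) h\<close> and \<open>x\<close> at
  time \<open>(2 k + 2) h\<close> with probability at least \<open>\<delta>\<close>. The index of the first such block is
  therefore dominated by a geometric variable.
\<close>

lemma finite_mean_return_time:
  assumes h: "0 < h" "\<And>x y. x \<in> S \<Longrightarrow> y \<in> S \<Longrightarrow> 0 < P h x y"
    and x: "x \<in> S" and a: "a \<in> S" and "a \<noteq> x"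
  shows "(\<integral>\<^sup>+ \<omega>. return_time X x \<omega> \<partial>Pr x) < \<infinity>"
proof -
  interpret prob_space "Pr x" by (rule prob_space_Pr[OF x])
  define t where "t i = real i * h" for i
  have t: "0 \<le> t i" "t i < t (Suc i)" "t (Suc i) - t i = h" for i
    using h(1) by (auto simp: t_def algebra_simps)
  \<comment> \<open>\<open>miss k\<close> says that none of the first \<open>k\<close> blocks is a
    hit, that is, shows \<open>a\<close> and then \<open>x\<close>; \<open>H k\<close> below is the
    event that block \<open>k\<close> is a hit.\<close>
  define miss where "miss k f \<longleftrightarrow> (\<forall>i\<in>{..<k}. \<not> (f (2 * i + 1) = a \<and> f (2 * i + 2) = x))"
    for k and f :: "nat \<Rightarrow> 'a"
  define F where "F k = {\<omega> \<in> space (Pr x). miss k (\<lambda>i. X (t i) \<omega>)}" for k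
  define H where "H k = {\<omega> \<in> space (Pr x). X (t (2 * k + 1)) \<omega> = a \<and> X (t (2 * k + 2)) \<omega> = x}" for k
  \<comment> \<open>The minimum over the state \<open>z\<close> at the start of a block makes the
    bound uniform; it is attained, hence positive.\<close>
  define \<delta> where "\<delta> = Min ((\<lambda>z. P h z a * P h a x) ` S)"
  have \<delta>_le: "\<delta> \<le> P h z a * P h a x" if "z \<in> S" for z
    unfolding \<delta>_def using finite_states that by (intro Min_le) auto
  have "\<delta> \<in> (\<lambda>z. P h z a * P h a x) ` S"
    unfolding \<delta>_def using finite_states x by (intro Min_in) auto
  then obtain z0 where "z0 \<in> S" and \<delta>_eq: "\<delta> = P h z0 a * P h a x"
    by auto
  then have "0 < \<delta>"
    unfolding \<delta>_eq using h(2) x a by simp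
  have "\<delta> \<le> 1"
    unfolding \<delta>_eq using \<open>z0 \<in> S\<close> a by (simp add: P_le_1 P_nonneg mult_le_one)
  have H_sets: "H k \<in> sets (Pr x)" for k
    unfolding H_def by (intro sets.sets_Collect_conj sets_X_eq x t)
  have F_sets: "F k \<in> sets (Pr x)" for k
    unfolding F_def miss_def
    by (intro sets.sets_Collect_finite_All sets.sets_Collect_neg sets.sets_Collect_conj sets_X_eq x t) simp
  have F_Suc: "F (Suc k) = F k - F k \<inter> H k" for k
    by (auto simp: F_def H_def miss_def less_Suc_eq)
  \<comment> \<open>The last sample that \<open>miss k\<close> reads has index 2 (k - 1) + 2 = 2 k,
    so it is an event of the past at the start of block \<open>k\<close>.\<close>
  have miss_cong: "miss k f = miss k g" if "\<And>i. i \<le> 2 * k \<Longrightarrow> f i = g i" for k f g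
  proof -
    have "f (2 * i + 1) = g (2 * i + 1)" "f (2 * i + 2) = g (2 * i + 2)" if "i < k" for i
      using that by (auto intro!: \<open>\<And>i. i \<le> 2 * k \<Longrightarrow> f i = g i\<close>)
    then show ?thesis
      unfolding miss_def by (intro ball_cong) auto
  qed
  have block: "measure (Pr x) {\<omega> \<in> F k \<inter> H k. X (t (2 * k)) \<omega> = z} =
      measure (Pr x) {\<omega> \<in> F k. X (t (2 * k)) \<omega> = z} * (P h z a * P h a x)" for k z
  proof -
    \<comment> \<open>\<open>markov_past\<close> is applied twice, to the last step of the block
      first: \<open>B\<close> is the past up to \<open>a\<close>, and \<open>A\<close> the past up
      to the start \<open>z\<close> of the block.\<close>
    define A where "A f \<longleftrightarrow> miss k f \<and> f (2 * k) = z" for f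
    define B where "B f \<longleftrightarrow> A f \<and> f (Suc (2 * k)) = a" for f
    have A_cong: "A f = A g" if "\<And>i. i \<le> 2 * k \<Longrightarrow> f i = g i" for f g
      unfolding A_def using miss_cong[of k f g] that by simp
    have B_cong: "B f = B g" if "\<And>i. i \<le> Suc (2 * k) \<Longrightarrow> f i = g i" for f g
      unfolding B_def using A_cong[of f g] that by simp
    have "measure (Pr x) {\<omega> \<in> space (Pr x). B (\<lambda>i. X (t i) \<omega>) \<and> X (t (Suc (Suc (2 * k)))) \<omega> = x} =
        measure (Pr x) {\<omega> \<in> space (Pr x). B (\<lambda>i. X (t i) \<omega>)} *
          P (t (Suc (Suc (2 * k))) - t (Suc (2 * k))) a x"
      by (rule markov_past[where m = "Suc (2 * k)" and t = t and A = B, OF x t(1,2) x B_cong]) (auto simp: B_def)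
    also have "{\<omega> \<in> space (Pr x). B (\<lambda>i. X (t i) \<omega>)} =
        {\<omega> \<in> space (Pr x). A (\<lambda>i. X (t i) \<omega>) \<and> X (t (Suc (2 * k))) \<omega> = a}"
      by (simp add: B_def)
    also have "measure (Pr x) \<dots> =
        measure (Pr x) {\<omega> \<in> space (Pr x). A (\<lambda>i. X (t i) \<omega>)} * P (t (Suc (2 * k)) - t (2 * k)) z a"
      by (rule markov_past[where m = "2 * k" and t = t and A = A, OF x t(1,2) a A_cong]) (auto simp: A_def)
    also have "{\<omega> \<in> space (Pr x). A (\<lambda>i. X (t i) \<omega>)} = {\<omega> \<in> F k. X (t (2 * k)) \<omega> = z}"
      by (auto simp: A_def F_def)
    also have "{\<omega> \<in> space (Pr x). B (\<lambda>i. X (t i) \<omega>) \<and> X (t (Suc (Suc (2 * k)))) \<omega> = x} =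
        {\<omega> \<in> F k \<inter> H k. X (t (2 * k)) \<omega> = z}"
      by (auto simp: B_def A_def F_def H_def)
    finally show ?thesis
      by (simp add: t(3))
  qed
  have decay: "measure (Pr x) (F (Suc k)) \<le> (1 - \<delta>) * measure (Pr x) (F k)" for k
  proof -
    have "\<delta> * measure (Pr x) (F k) =
        (\<Sum>z\<in>S. measure (Pr x) {\<omega> \<in> F k. X (t (2 * k)) \<omega> = z} * \<delta>)"
      by (subst measure_sum_X[OF x t(1)[of "2 * k"] F_sets]) (simp add: sum_distrib_left mult.commute)
    also have "\<dots> \<le> (\<Sum>z\<in>S. measure (Pr x) {\<omega> \<in> F k \<inter> H k. X (t (2 * k)) \<omega> = z})"
      unfolding block by (intro sum_mono mult_left_mono \<delta>_le) auto
    also have "\<dots> = measure (Pr x) (F k \<inter> H k)"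
      by (rule measure_sum_X[OF x t(1), symmetric]) (intro sets.Int F_sets H_sets)
    finally show ?thesis
      using F_sets H_sets unfolding F_Suc by (subst finite_measure_Diff) (auto simp: algebra_simps)
  qed
  have F_le: "measure (Pr x) (F k) \<le> (1 - \<delta>) ^ k" for k
  proof (induction k)
    case (Suc k)
    have "measure (Pr x) (F (Suc k)) \<le> (1 - \<delta>) * measure (Pr x) (F k)"
      by (rule decay)
    also have "\<dots> \<le> (1 - \<delta>) * (1 - \<delta>) ^ k"
      using \<open>\<delta> \<le> 1\<close> by (intro mult_left_mono Suc.IH) simp
    finally show ?case by simp
  qed simp
  \<comment> \<open>If block K is the first hit, K + 1 summands equal 2 h and add up to the time t
    (2 K + 2), at which the path is back at \<open>x\<close>. Without a hit the series is
    infinite.\<close>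
  have bound: "return_time X x \<omega> \<le> (\<Sum>k. ennreal (2 * h) * indicator (F k) \<omega>)"
    if \<omega>: "\<omega> \<in> space (Pr x)" for \<omega>
  proof -
    have partial: "ennreal (real n * (2 * h)) \<le> (\<Sum>k. ennreal (2 * h) * indicator (F k) \<omega>)"
      if "\<And>k. k < n \<Longrightarrow> \<omega> \<in> F k" for n
    proof -
      have "ennreal (real n * (2 * h)) = (\<Sum>k<n. ennreal (2 * h) * indicator (F k) \<omega>)"
        using that h(1) by (simp add: ennreal_mult ennreal_of_nat_eq_real_of_nat)
      also have "\<dots> \<le> (\<Sum>k. ennreal (2 * h) * indicator (F k) \<omega>)"
        by (rule sum_le_suminf) auto
      finally show ?thesis .
    qed
    show ?thesis
    proof (cases "\<exists>k. \<omega> \<in> H k")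
      case True
      define K where "K = (LEAST k. \<omega> \<in> H k)"
      have HK: "\<omega> \<in> H K"
        unfolding K_def using True by (rule LeastI_ex)
      \<comment> \<open>The index K is included: \<open>F K\<close> excludes only hits in blocks
        before K.\<close>
      have "\<omega> \<in> F k" if "k < Suc K" for k
      proof -
        have "\<omega> \<notin> H i" if "i < k" for i
          using not_less_Least[of i "\<lambda>k. \<omega> \<in> H k"] that \<open>k < Suc K\<close> by (simp add: K_def)
        then show ?thesis
          using \<omega> by (simp add: F_def miss_def H_def)
      qed
      moreover have "return_time X x \<omega> \<le> ennreal (t (2 * K + 2))"
        unfolding return_time_def
      proof (rule Inf_lower, intro CollectI exI conjI)
        show "X (t (2 * K + 2)) \<omega> = x" "X (t (2 * K + 1)) \<omega> \<noteq> x"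
          using HK \<open>a \<noteq> x\<close> by (auto simp: H_def)
        show "t (2 * K + 1) < t (2 * K + 2)"
          using t(2)[of "2 * K + 1"] by simp
      qed (auto intro: t)
      moreover have "t (2 * K + 2) = real (Suc K) * (2 * h)"
        by (simp add: t_def algebra_simps)
      ultimately show ?thesis
        using partial[of "Suc K"] order_trans by metis
    next
      case False
      then have "\<omega> \<in> F k" for k
        using \<omega> by (auto simp: F_def miss_def H_def)
      then have le: "ennreal (real n * (2 * h)) \<le> (\<Sum>k. ennreal (2 * h) * indicator (F k) \<omega>)" for n
        using partial by blast
      have "(\<Sum>k. ennreal (2 * h) * indicator (F k) \<omega>) = top"
      proof (cases "\<Sum>k. ennreal (2 * h) * indicator (F k) \<omega>" rule: ennreal_cases)
        case (real r)
        obtain n where "r < real n * (2 * h)"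
          using reals_Archimedean3[of "2 * h"] h(1) by auto
        then show ?thesis
          using le[of n] real h(1) by simp
      qed
      then show ?thesis by simp
    qed
  qed
  have "(\<integral>\<^sup>+ \<omega>. return_time X x \<omega> \<partial>Pr x) \<le>
      (\<integral>\<^sup>+ \<omega>. (\<Sum>k. ennreal (2 * h) * indicator (F k) \<omega>) \<partial>Pr x)"
    \<comment> \<open>\<open>return_time\<close> is an infimum over uncountably many times. The
      integral is monotone for arbitrary functions, so the pointwise bound by a measurable series
      suffices.\<close>
    by (rule nn_integral_mono) (rule bound)
  also have "\<dots> = (\<Sum>k. \<integral>\<^sup>+ \<omega>. ennreal (2 * h) * indicator (F k) \<omega> \<partial>Pr x)"
    using F_sets by (intro nn_integral_suminf) auto
  also have "\<dots> = (\<Sum>k. ennreal (2 * h * measure (Pr x) (F k)))"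
    using F_sets h(1) by (simp add: nn_integral_cmult_indicator emeasure_eq_measure ennreal_mult)
  also have "\<dots> \<le> (\<Sum>k. ennreal (2 * h * (1 - \<delta>) ^ k))"
    using h(1) F_le by (intro suminf_le ennreal_leI mult_left_mono) auto
  also have "\<dots> < \<infinity>"
  proof -
    have "summable (\<lambda>k. 2 * h * (1 - \<delta>) ^ k)"
      using \<open>0 < \<delta>\<close> \<open>\<delta> \<le> 1\<close> by (intro summable_mult summable_geometric) auto
    then have "(\<Sum>k. ennreal (2 * h * (1 - \<delta>) ^ k)) = ennreal (\<Sum>k. 2 * h * (1 - \<delta>) ^ k)"
      using h(1) \<open>\<delta> \<le> 1\<close> by (intro suminf_ennreal2) auto
    then show ?thesis by simp
  qed
  finally show ?thesis .
qed

section \<open>Time reversal of the finite-dimensional laws\<close>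

text \<open>Stationarity absorbs the factor \<open>P (t 0)\<close>; what remains depends on time
  increments alone, which reversal preserves.\<close>

lemma finite_dimensional_stationary:
  assumes stationary: "\<And>t y. 0 \<le> t \<Longrightarrow> y \<in> S \<Longrightarrow> (\<Sum>x\<in>S. \<mu> x * P t x y) = \<mu> y"
    and t: "0 \<le> t 0" "\<And>i. i < m \<Longrightarrow> t i < t (Suc i)" and z: "\<And>i. i \<le> m \<Longrightarrow> z i \<in> S"
  shows "(\<Sum>x\<in>S. \<mu> x * measure (Pr x) {\<omega> \<in> space (Pr x). \<forall>i\<le>m. X (t i) \<omega> = z i}) =
    \<mu> (z 0) * (\<Prod>i<m. P (t (Suc i) - t i) (z i) (z (Suc i)))"
proof -
  have "(\<Sum>x\<in>S. \<mu> x * measure (Pr x) {\<omega> \<in> space (Pr x). \<forall>i\<le>m. X (t i) \<omega> = z i}) =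
      (\<Sum>x\<in>S. \<mu> x * P (t 0) x (z 0) * (\<Prod>i<m. P (t (Suc i) - t i) (z i) (z (Suc i))))"
  proof (intro sum.cong refl)
    fix x assume "x \<in> S"
    then show "\<mu> x * measure (Pr x) {\<omega> \<in> space (Pr x). \<forall>i\<le>m. X (t i) \<omega> = z i} =
        \<mu> x * P (t 0) x (z 0) * (\<Prod>i<m. P (t (Suc i) - t i) (z i) (z (Suc i)))"
      by (subst finite_dimensional[OF _ t z]) (simp_all add: mult.assoc)
  qed
  also have "\<dots> = \<mu> (z 0) * (\<Prod>i<m. P (t (Suc i) - t i) (z i) (z (Suc i)))"
    using stationary[OF t(1) z[of 0]] by (simp flip: sum_distrib_right)
  finally show ?thesis .
qed

lemma reverse_finite_dimensional:
  assumes balance: "\<And>t x y. 0 \<le> t \<Longrightarrow> x \<in> S \<Longrightarrow> y \<in> S \<Longrightarrow> \<mu> x * P t x y = \<mu> y * P t y x"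
    and stationary: "\<And>t y. 0 \<le> t \<Longrightarrow> y \<in> S \<Longrightarrow> (\<Sum>x\<in>S. \<mu> x * P t x y) = \<mu> y"
    and t: "0 \<le> t 0" "\<And>i. i < m \<Longrightarrow> t i < t (Suc i)" "t m \<le> T"
    and z: "\<And>i. i \<le> m \<Longrightarrow> z i \<in> S"
  shows "(\<Sum>x\<in>S. \<mu> x * measure (Pr x) {\<omega> \<in> space (Pr x). \<forall>i\<le>m. X (T - t i) \<omega> = z i}) =
    (\<Sum>x\<in>S. \<mu> x * measure (Pr x) {\<omega> \<in> space (Pr x). \<forall>i\<le>m. X (t i) \<omega> = z i})"
proof -
  \<comment> \<open>The times \<open>T - t i\<close> decrease in i; \<open>u\<close> and
    \<open>v\<close> list them, with their values, in increasing order.\<close>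
  define u where "u i = T - t (m - i)" for i
  define v where "v i = z (m - i)" for i
  have u: "u i < u (Suc i)" if "i < m" for i
    using t(2)[of "m - Suc i"] that by (auto simp: u_def Suc_diff_Suc)
  have u0: "0 \<le> u 0"
    using t(3) by (simp add: u_def)
  have events: "{\<omega> \<in> space (Pr x). \<forall>i\<le>m. X (T - t i) \<omega> = z i} =
      {\<omega> \<in> space (Pr x). \<forall>i\<le>m. X (u i) \<omega> = v i}" for x
    unfolding u_def v_def by (metis diff_diff_cancel diff_le_self)
  have "(\<Sum>x\<in>S. \<mu> x * measure (Pr x) {\<omega> \<in> space (Pr x). \<forall>i\<le>m. X (T - t i) \<omega> = z i}) =
      \<mu> (v 0) * (\<Prod>i<m. P (u (Suc i) - u i) (v i) (v (Suc i)))"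
    unfolding events
    by (rule finite_dimensional_stationary[OF stationary u0 u]) (auto simp: v_def z)
  also have "(\<Prod>i<m. P (u (Suc i) - u i) (v i) (v (Suc i))) =
      (\<Prod>i<m. P (t (Suc (m - Suc i)) - t (m - Suc i)) (z (Suc (m - Suc i))) (z (m - Suc i)))"
    by (intro prod.cong) (auto simp: u_def v_def Suc_diff_Suc)
  also have "\<dots> = (\<Prod>i<m. P (t (Suc i) - t i) (z (Suc i)) (z i))"
    by (rule prod.nat_diff_reindex)
  also have "\<mu> (v 0) * \<dots> = \<mu> (z 0) * (\<Prod>i<m. P (t (Suc i) - t i) (z i) (z (Suc i)))"
  proof -
    \<comment> \<open>Detailed balance carries \<mu> along the chain, one transition at a time; the
      induction therefore runs over the prefixes of the path.\<close>
    have "\<mu> (z k) * (\<Prod>i<k. P (t (Suc i) - t i) (z (Suc i)) (z i)) =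
        \<mu> (z 0) * (\<Prod>i<k. P (t (Suc i) - t i) (z i) (z (Suc i)))" if "k \<le> m" for k
      using that
    proof (induction k)
      case (Suc k)
      have "\<mu> (z (Suc k)) * P (t (Suc k) - t k) (z (Suc k)) (z k) =
          \<mu> (z k) * P (t (Suc k) - t k) (z k) (z (Suc k))"
        using t(2)[of k] Suc.prems by (intro balance z) auto
      then have "\<mu> (z (Suc k)) * (\<Prod>i<Suc k. P (t (Suc i) - t i) (z (Suc i)) (z i)) =
          (\<mu> (z k) * (\<Prod>i<k. P (t (Suc i) - t i) (z (Suc i)) (z i))) * P (t (Suc k) - t k) (z k) (z (Suc k))"
        by simp
      also have "\<mu> (z k) * (\<Prod>i<k. P (t (Suc i) - t i) (z (Suc i)) (z i)) =
          \<mu> (z 0) * (\<Prod>i<k. P (t (Suc i) - t i) (z i) (z (Suc i)))"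
        using Suc by simp
      finally show ?case
        by (simp add: mult.assoc)
    qed simp
    then show ?thesis
      by (simp add: v_def)
  qed
  also have "\<dots> = (\<Sum>x\<in>S. \<mu> x * measure (Pr x) {\<omega> \<in> space (Pr x). \<forall>i\<le>m. X (t i) \<omega> = z i})"
    by (rule finite_dimensional_stationary[OF stationary t(1,2) z, symmetric])
  finally show ?thesis .
qed

text \<open>The definition admits times in any order, with repetitions, and values outside
  \<open>S\<close>. Consistent requirements reduce to a strictly increasing list of times;
  inconsistent ones describe empty events on both sides.\<close>

lemma reversible_if_detailed_balance:
  assumes balance: "\<And>t x y. 0 \<le> t \<Longrightarrow> x \<in> S \<Longrightarrow> y \<in> S \<Longrightarrow> \<mu> x * P t x y = \<mu> y * P t y x"
    and stationary: "\<And>t y. 0 \<le> t \<Longrightarrow> y \<in> S \<Longrightarrow> (\<Sum>x\<in>S. \<mu> x * P t x y) = \<mu> y"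
  shows "reversible S Pr X \<mu>"
  unfolding reversible_def
proof (intro allI impI)
  fix T :: real and m :: nat and t z
  assume t: "\<forall>i<m. 0 \<le> t i \<and> t i \<le> T"
  let ?E = "\<lambda>x. {\<omega> \<in> space (Pr x). \<forall>i<m. X (t i) \<omega> = z i}"
  let ?E' = "\<lambda>x. {\<omega> \<in> space (Pr x). \<forall>i<m. X (T - t i) \<omega> = z i}"
  consider (none) "m = 0"
    | (impossible) i j where "i < m" "j < m" "z i \<notin> S \<or> t i = t j \<and> z i \<noteq> z j"
    | (possible) "0 < m" "\<And>i. i < m \<Longrightarrow> z i \<in> S" "\<And>i j. i < m \<Longrightarrow> j < m \<Longrightarrow> t i = t j \<Longrightarrow> z i = z j"
    by blast
  then show "(\<Sum>x\<in>S. \<mu> x * measure (Pr x) (?E x)) = (\<Sum>x\<in>S. \<mu> x * measure (Pr x) (?E' x))"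
  proof cases
    case none
    then show ?thesis by simp
  next
    case impossible
    have "measure (Pr x) (?E x) = measure (Pr x) (?E' x)" if "x \<in> S" for x
    proof -
      \<comment> \<open>A clash at \<open>t i = t j\<close> is also a clash at
        \<open>T - t i = T - t j\<close>, and no value outside \<open>S\<close> is ever
        taken.\<close>
      have "\<not> (\<forall>i<m. X (t i) \<omega> = z i) \<and> \<not> (\<forall>i<m. X (T - t i) \<omega> = z i)"
        if "\<omega> \<in> space (Pr x)" for \<omega>
      proof -
        have "X (t i) \<omega> \<in> S" "X (T - t i) \<omega> \<in> S"
          using X_in_S[OF \<open>x \<in> S\<close> _ that] t impossible(1) by auto
        then show ?thesis
          using impossible by metis
      qed
      then have "?E x = {}" "?E' x = {}"
        by blast+
      then show ?thesis
        by (simp only:)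
    qed
    then show ?thesis
      by (intro sum.cong refl arg_cong2[of _ _ _ _ times])
  next
    case possible
    \<comment> \<open>Equal times carry equal values here, so the value is a function of the time,
      whichever index \<open>inv_into\<close> selects.\<close>
    define v where "v s = z (inv_into {..<m} t s)" for s
    define us where "us = sorted_list_of_set (t ` {..<m})"
    define n where "n = length us - 1"
    have v: "v (t i) = z i" if "i < m" for i
    proof -
      have "t i \<in> t ` {..<m}" using that by auto
      then have "inv_into {..<m} t (t i) < m" "t (inv_into {..<m} t (t i)) = t i"
        using inv_into_into[of "t i" t "{..<m}"] f_inv_into_f[of "t i" t "{..<m}"] by auto
      then show ?thesis
        unfolding v_def using possible(3) that by blast
    qed
    have set_us: "set us = t ` {..<m}"
      by (simp add: us_def)
    have "us \<noteq> []"
      using set_us possible(1) by auto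
    then have len: "length us = Suc n"
      by (simp add: n_def)
    have us_in: "us ! i \<in> t ` {..<m}" if "i \<le> n" for i
      using nth_mem[of i us] that len set_us by simp
    \<comment> \<open>\<open>R\<close> is arbitrary so that one reindexing serves both
      \<open>X s\<close> and \<open>X (T - s)\<close>.\<close>
    have quantify: "(\<forall>i<m. R (t i) (z i)) \<longleftrightarrow> (\<forall>i\<le>n. R (us ! i) (v (us ! i)))" for R
    proof -
      have "(\<forall>i<m. R (t i) (z i)) \<longleftrightarrow> (\<forall>s\<in>set us. R s (v s))"
        using v by (auto simp: set_us)
      also have "\<dots> \<longleftrightarrow> (\<forall>i\<le>n. R (us ! i) (v (us ! i)))"
        by (simp add: all_set_conv_all_nth len less_Suc_eq_le)
      finally show ?thesis .
    qed
    have "us ! i < us ! Suc i" if "i < n" for i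
      using strict_sorted_list_of_set[of "t ` {..<m}"] that len
      by (simp add: us_def sorted_wrt_nth_less)
    moreover have "0 \<le> us ! 0" "us ! n \<le> T"
      using us_in[of 0] us_in[of n] t by auto
    moreover have "v (us ! i) \<in> S" if "i \<le> n" for i
      using us_in[OF that] v possible(2) by auto
    ultimately have "(\<Sum>x\<in>S. \<mu> x * measure (Pr x) {\<omega> \<in> space (Pr x). \<forall>i\<le>n. X (T - us ! i) \<omega> = v (us ! i)}) =
        (\<Sum>x\<in>S. \<mu> x * measure (Pr x) {\<omega> \<in> space (Pr x). \<forall>i\<le>n. X (us ! i) \<omega> = v (us ! i)})"
      by (intro reverse_finite_dimensional balance stationary) auto
    moreover have "?E x = {\<omega> \<in> space (Pr x). \<forall>i\<le>n. X (us ! i) \<omega> = v (us ! i)}" for x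
      by (simp only: quantify[of "\<lambda>s w. X s _ = w"])
    moreover have "?E' x = {\<omega> \<in> space (Pr x). \<forall>i\<le>n. X (T - us ! i) \<omega> = v (us ! i)}" for x
      by (simp only: quantify[of "\<lambda>s w. X (T - s) _ = w"])
    ultimately show ?thesis
      by simp
  qed
qed

end

section \<open>Moves of a single particle and connectivity of the configurations\<close>

lemma sum_move:
  fixes n :: "'s::finite \<Rightarrow> nat"
  assumes "k \<noteq> l" "1 \<le> n k"
  shows "(\<Sum>s\<in>UNIV. move k l n s) = (\<Sum>s\<in>UNIV. n s)"
proof -
  have split: "(\<Sum>s\<in>UNIV. f s) = f k + (f l + (\<Sum>s\<in>UNIV - {k} - {l}. f s))" for f :: "'s \<Rightarrow> nat"
    using assms(1) by (simp add: sum.remove[of UNIV k] sum.remove[of "UNIV - {k}" l])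
  have "(\<Sum>s\<in>UNIV - {k} - {l}. move k l n s) = (\<Sum>s\<in>UNIV - {k} - {l}. n s)"
    by (intro sum.cong) (auto simp: move_def)
  then show ?thesis
    unfolding split[of "move k l n"] split[of n] using assms by (simp add: move_def)
qed

lemma move_move: "k \<noteq> l \<Longrightarrow> 1 \<le> n k \<Longrightarrow> move l k (move k l n) = n"
  by (auto simp: move_def fun_eq_iff)

lemma move_neq: "k \<noteq> l \<Longrightarrow> move k l n \<noteq> n"
  by (auto simp: move_def fun_eq_iff)

text \<open>Two different configurations of equal total have a site with a surplus and one with a
  deficit; a move between these lowers the total surplus. The map \<open>f\<close> embeds a
  configuration into a state, as tasks or as customers.\<close>

lemma move_connected:
  fixes n n' :: "'s::finite \<Rightarrow> nat"
  assumes step: "\<And>n k l. (\<Sum>s\<in>UNIV. n s) = (\<Sum>s\<in>UNIV. n' s) \<Longrightarrow> k \<noteq> l \<Longrightarrow> 1 \<le> n k \<Longrightarrow>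
      (f n, f (move k l n)) \<in> R"
    and "(\<Sum>s\<in>UNIV. n s) = (\<Sum>s\<in>UNIV. n' s)"
  shows "(f n, f n') \<in> R\<^sup>*"
  using assms(2)
proof (induction "\<Sum>s\<in>UNIV. n s - n' s" arbitrary: n rule: less_induct)
  case less
  show ?case
  proof (cases "n = n'")
    case False
    obtain k where k: "n' k < n k"
    proof (rule ccontr)
      assume "\<not> thesis"
      then have le: "n s \<le> n' s" for s
        using that not_le by blast
      moreover obtain s where "n s \<noteq> n' s"
        using False by auto
      ultimately have "(\<Sum>s\<in>UNIV. n s) < (\<Sum>s\<in>UNIV. n' s)"
        by (intro sum_strict_mono_ex1) (auto intro: le_neq_trans)
      then show False using less.prems by simp
    qed
    obtain l where l: "n l < n' l"
    proof (rule ccontr)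
      assume "\<not> thesis"
      then have le: "n' s \<le> n s" for s
        using that not_le by blast
      then have "(\<Sum>s\<in>UNIV. n' s) < (\<Sum>s\<in>UNIV. n s)"
        using k by (intro sum_strict_mono_ex1) auto
      then show False using less.prems by simp
    qed
    have "k \<noteq> l" "1 \<le> n k" using k l by auto
    \<comment> \<open>By truncated subtraction the summand at \<open>l\<close> is 0 before and after
      the move; only the summand at \<open>k\<close> changes.\<close>
    have "(\<Sum>s\<in>UNIV. move k l n s - n' s) < (\<Sum>s\<in>UNIV. n s - n' s)"
      using k l by (intro sum_strict_mono_ex1) (auto simp: move_def intro!: bexI[of _ k])
    then have "(f (move k l n), f n') \<in> R\<^sup>*"
      using less sum_move[of k l n] \<open>k \<noteq> l\<close> \<open>1 \<le> n k\<close> by simp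
    moreover have "(f n, f (move k l n)) \<in> R"
      using step less.prems \<open>k \<noteq> l\<close> \<open>1 \<le> n k\<close> by blast
    ultimately show ?thesis
      by (rule converse_rtrancl_into_rtrancl[rotated])
  qed simp
qed

lemma states_nonempty: "states M N \<noteq> ({} :: 's::finite state set)"
proof -
  fix a :: 's
  have "((\<lambda>s. if s = a then M else 0), (\<lambda>s. if s = a then N else 0)) \<in> states M N"
    by (simp add: states_def)
  then show ?thesis by blast
qed

lemma move_customer_states:
  "(y, n) \<in> states M N \<Longrightarrow> k \<noteq> l \<Longrightarrow> 1 \<le> y k \<Longrightarrow> (move k l y, n) \<in> states M N"
  by (simp add: states_def sum_move)

lemma move_task_states:
  "(y, n) \<in> states M N \<Longrightarrow> k \<noteq> l \<Longrightarrow> 1 \<le> n k \<Longrightarrow> (y, move k l n) \<in> states M N"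
  by (simp add: states_def sum_move)

lemma gamma_bar_Suc: "gamma_bar \<gamma> i (Suc n) = gamma_bar \<gamma> i n * \<gamma> i n"
  by (simp add: gamma_bar_def)

lemma weight_split:
  assumes "k \<noteq> l"
  shows "weight \<gamma> (y, n) = gamma_bar \<gamma> k (n k) ^ y k * gamma_bar \<gamma> l (n l) ^ y l *
    (\<Prod>j\<in>UNIV - {k} - {l}. gamma_bar \<gamma> j (n j) ^ y j)"
  using assms by (simp add: weight_def prod.remove[of UNIV k] prod.remove[of "UNIV - {k}" l] mult.assoc)

section \<open>Positivity and detailed balance of the network rates\<close>

locale network =
  fixes M N :: nat
    and \<gamma> :: "'s::finite \<Rightarrow> nat \<Rightarrow> real"
    and \<beta> \<theta> \<epsilon> :: "'s task_array"
    and \<tau> :: "'s customer_array"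
  assumes gamma_nonneg: "\<And>i n. 0 \<le> \<gamma> i n"
    and gamma_bar_pos:
      "\<And>y n j. (y, n) \<in> states M N \<Longrightarrow> 1 \<le> y j \<Longrightarrow> 0 < gamma_bar \<gamma> j (n j)"
    and beta_pos:
      "\<And>y n k l. (y, n) \<in> states M N \<Longrightarrow> k \<noteq> l \<Longrightarrow> y k = 0 \<Longrightarrow> y l = 0 \<Longrightarrow>
         0 < \<beta> k l (n k) (n l) y"
    and theta_pos:
      "\<And>y n j k. (y, n) \<in> states M N \<Longrightarrow> 1 \<le> y j \<Longrightarrow> y k = 0 \<Longrightarrow>
         0 < \<theta> j k (n j) (n k) y \<and> 0 < \<theta> k j (n k) (n j) y"
    and epsilon_pos:
      "\<And>y n i j. (y, n) \<in> states M N \<Longrightarrow> i \<noteq> j \<Longrightarrow> 1 \<le> y i \<Longrightarrow> 1 \<le> y j \<Longrightarrow>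
         0 < \<epsilon> i j (n i) (n j) y"
    and tau_pos:
      "\<And>y n j j'. (y, n) \<in> states M N \<Longrightarrow> 1 \<le> y j \<Longrightarrow> j' \<noteq> j \<Longrightarrow> 0 < \<tau> j j' n y"
    and beta_sym:
      "\<And>y n k l. (y, n) \<in> states M N \<Longrightarrow> k \<noteq> l \<Longrightarrow> y k = 0 \<Longrightarrow> y l = 0 \<Longrightarrow> 1 \<le> n k \<Longrightarrow>
         \<beta> k l (n k) (n l) y = \<beta> l k (n l + 1) (n k - 1) y"
    and theta_sym:
      "\<And>y n j k. (y, n) \<in> states M N \<Longrightarrow> 1 \<le> y j \<Longrightarrow> y k = 0 \<Longrightarrow> 1 \<le> n j \<Longrightarrow>
         \<theta> j k (n j) (n k) y = \<theta> k j (n k + 1) (n j - 1) y"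
    and epsilon_sym:
      "\<And>y n i j. (y, n) \<in> states M N \<Longrightarrow> i \<noteq> j \<Longrightarrow> 1 \<le> y i \<Longrightarrow> 1 \<le> y j \<Longrightarrow> 1 \<le> n i \<Longrightarrow>
         \<epsilon> i j (n i) (n j) y * \<gamma> i (n i - 1) ^ y i = \<gamma> j (n j) ^ y j * \<epsilon> j i (n j + 1) (n i - 1) y"
    and tau_sym:
      "\<And>y n j j'. (y, n) \<in> states M N \<Longrightarrow> 1 \<le> y j \<Longrightarrow> j' \<noteq> j \<Longrightarrow>
         \<tau> j j' n y = \<tau> j' j n (move j j' y)"
begin

text \<open>\<open>gamma_bar\<close> may vanish at a site without customers, but there the exponent
  is 0.\<close>

lemma gamma_bar_power_pos: "(y, n) \<in> states M N \<Longrightarrow> 0 < gamma_bar \<gamma> j (n j) ^ y j"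
  using gamma_bar_pos[of y n j] by (cases "y j = 0") auto

lemma weight_pos: "s \<in> states M N \<Longrightarrow> 0 < weight \<gamma> s"
  by (cases s) (auto simp: weight_def intro!: prod_pos gamma_bar_power_pos)

lemma task_rate_pos:
  assumes s: "(y, n) \<in> states M N" and "k \<noteq> l" "1 \<le> n k"
  shows "0 < task_rate \<gamma> \<beta> \<theta> \<epsilon> y n k l"
proof -
  \<comment> \<open>The state after the move is again in \<open>states M N\<close>, and there
    \<open>gamma_bar \<gamma> l (n l + 1)\<close> is positive and has the factor
    \<open>\<gamma> l (n l)\<close>.\<close>
  have "0 < \<gamma> l (n l)" if "1 \<le> y l"
  proof -
    have "0 < gamma_bar \<gamma> l (Suc (n l))"
      using gamma_bar_pos[OF move_task_states[OF assms], of l] that assms by (simp add: move_def)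
    then show ?thesis
      using gamma_nonneg[of l "n l"] by (auto simp: gamma_bar_Suc order.order_iff_strict)
  qed
  then show ?thesis
    using beta_pos[OF s, of k l] epsilon_pos[OF s, of k l] theta_pos[OF s, of k l] theta_pos[OF s, of l k]
      assms(2)
    by (auto simp: task_rate_def not_less_eq_eq)
qed

lemma customer_rate_pos:
  assumes "(y, n) \<in> states M N" "j' \<noteq> j" "1 \<le> y j"
  shows "0 < customer_rate \<gamma> \<tau> y n j j'"
  unfolding customer_rate_def
  using assms by (intro mult_pos_pos positive_imp_inverse_positive gamma_bar_power_pos tau_pos)

lemma task_balance:
  assumes s: "(y, n) \<in> states M N" and kl: "k \<noteq> l" and nk: "1 \<le> n k"
  shows "weight \<gamma> (y, n) * task_rate \<gamma> \<beta> \<theta> \<epsilon> y n k l =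
    weight \<gamma> (y, move k l n) * task_rate \<gamma> \<beta> \<theta> \<epsilon> y (move k l n) l k"
proof -
  define n' where "n' = move k l n"
  define W where "W = (\<Prod>j\<in>UNIV - {k} - {l}. gamma_bar \<gamma> j (n j) ^ y j)"
  \<comment> \<open>With \<open>a\<close> taken at \<open>n k - 1\<close>, both weights are
    \<open>a * b * W\<close> times one power of \<gamma>: that of \<open>k\<close> before the move,
    that of \<open>l\<close> after it.\<close>
  define a where "a = gamma_bar \<gamma> k (n k - 1) ^ y k"
  define b where "b = gamma_bar \<gamma> l (n l) ^ y l"
  have s': "(y, n') \<in> states M N"
    unfolding n'_def by (rule move_task_states[OF assms])
  have n': "n' k = n k - 1" "n' l = n l + 1"
    using kl by (auto simp: n'_def move_def)
  have gk: "gamma_bar \<gamma> k (n k) = gamma_bar \<gamma> k (n k - 1) * \<gamma> k (n k - 1)"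
    using nk gamma_bar_Suc[of \<gamma> k "n k - 1"] by simp
  have w: "weight \<gamma> (y, n) = a * \<gamma> k (n k - 1) ^ y k * b * W"
    unfolding weight_split[OF kl] by (simp add: gk a_def b_def W_def power_mult_distrib)
  have "(\<Prod>j\<in>UNIV - {k} - {l}. gamma_bar \<gamma> j (n' j) ^ y j) = W"
    unfolding W_def by (intro prod.cong) (auto simp: n'_def move_def)
  then have w': "weight \<gamma> (y, n') = a * (b * \<gamma> l (n l) ^ y l) * W"
    unfolding weight_split[OF kl] by (simp add: n' a_def b_def gamma_bar_Suc power_mult_distrib)
  consider "y k = 0" "y l = 0" | "1 \<le> y k" "1 \<le> y l" | "1 \<le> y k" "y l = 0" | "y k = 0" "1 \<le> y l"
    by linarith
  then have "weight \<gamma> (y, n) * task_rate \<gamma> \<beta> \<theta> \<epsilon> y n k l =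
      weight \<gamma> (y, n') * task_rate \<gamma> \<beta> \<theta> \<epsilon> y n' l k"
  proof cases
    case 1
    then show ?thesis
      using beta_sym[OF s kl] nk by (simp add: w w' task_rate_def n')
  next
    case 2
    then have "\<epsilon> k l (n k) (n l) y * \<gamma> k (n k - 1) ^ y k = \<gamma> l (n l) ^ y l * \<epsilon> l k (n l + 1) (n k - 1) y"
      by (intro epsilon_sym s kl nk)
    then have "a * b * W * (\<epsilon> k l (n k) (n l) y * \<gamma> k (n k - 1) ^ y k) =
        a * b * W * (\<gamma> l (n l) ^ y l * \<epsilon> l k (n l + 1) (n k - 1) y)"
      by simp
    with 2 show ?thesis
      by (simp add: w w' task_rate_def n' mult_ac)
  next
    \<comment> \<open>The reverse move enters the occupied site \<open>k\<close>, so its rate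
      carries the power of \<gamma> that the weight has lost.\<close>
    case 3
    then show ?thesis
      using theta_sym[OF s, of k l] nk by (simp add: w w' task_rate_def n')
  next
    \<comment> \<open>\<open>theta_sym\<close> speaks of departures from an occupied site, so it is
      applied to the reverse move, in the state \<open>(y, n')\<close>.\<close>
    case 4
    then show ?thesis
      using theta_sym[OF s', of l k] nk by (simp add: w w' task_rate_def n')
  qed
  then show ?thesis by (simp add: n'_def)
qed

text \<open>The reciprocal factors of the rate cancel the contributions of both sites to the weight,
  in either direction. What remains is \<tau> times the product over the other sites.\<close>

lemma customer_balance:
  assumes s: "(y, n) \<in> states M N" and j: "j \<noteq> j'" "1 \<le> y j"
  shows "weight \<gamma> (y, n) * customer_rate \<gamma> \<tau> y n j j' =
    weight \<gamma> (move j j' y, n) * customer_rate \<gamma> \<tau> (move j j' y) n j' j"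
proof -
  define y' where "y' = move j j' y"
  define W where "W = (\<Prod>i\<in>UNIV - {j} - {j'}. gamma_bar \<gamma> i (n i) ^ y i)"
  have s': "(y', n) \<in> states M N"
    unfolding y'_def by (rule move_customer_states[OF assms])
  have pos: "gamma_bar \<gamma> i (n i) ^ y i \<noteq> 0" "gamma_bar \<gamma> i (n i) ^ y' i \<noteq> 0" for i
    using gamma_bar_power_pos[OF s, of i] gamma_bar_power_pos[OF s', of i] by (metis less_irrefl)+
  have W': "(\<Prod>i\<in>UNIV - {j'} - {j}. gamma_bar \<gamma> i (n i) ^ y' i) = W"
    unfolding W_def by (intro prod.cong) (auto simp: y'_def move_def)
  have cancel: "p * q * W * (inverse p * r * inverse q) = W * r" if "p \<noteq> 0" "q \<noteq> 0" for p q r :: real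
    using that by (simp add: field_simps)
  have "weight \<gamma> (y, n) * customer_rate \<gamma> \<tau> y n j j' = W * \<tau> j j' n y"
    unfolding weight_split[OF j(1)] customer_rate_def W_def[symmetric]
    by (rule cancel[OF pos(1) pos(1)])
  moreover have "weight \<gamma> (y', n) * customer_rate \<gamma> \<tau> y' n j' j = W * \<tau> j' j n y'"
    unfolding weight_split[OF j(1)[symmetric], of \<gamma> y'] customer_rate_def W'
    by (rule cancel[OF pos(2) pos(2)])
  ultimately show ?thesis
    using tau_sym[OF s j(2), of j'] j(1) by (simp add: y'_def)
qed

text \<open>The summand of the move k to l in one direction is paired with that of l to k in the
  other: both conditions hold or both fail, by \<open>undo_iff\<close>. Exchanging the two indices
  then restores the sum.\<close>

lemma rate_balance:
  assumes s: "s \<in> states M N" and s': "s' \<in> states M N"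
  shows "weight \<gamma> s * rate \<gamma> \<beta> \<theta> \<epsilon> \<tau> s s' = weight \<gamma> s' * rate \<gamma> \<beta> \<theta> \<epsilon> \<tau> s' s"
proof -
  obtain y n y' n' where eq: "s = (y, n)" "s' = (y', n')"
    by (metis surj_pair)
  define A where "A y n s' k l =
    (if 1 \<le> n k \<and> s' = (y, move k l n) then task_rate \<gamma> \<beta> \<theta> \<epsilon> y n k l else 0)" for y n s' k l
  define B where "B y n s' k l =
    (if 1 \<le> y k \<and> s' = (move k l y, n) then customer_rate \<gamma> \<tau> y n k l else 0)" for y n s' k l
  have undo: "1 \<le> n' l \<and> n = move l k n'" if "k \<noteq> l" "1 \<le> n k" "n' = move k l n"
    for n n' :: "'s \<Rightarrow> nat" and k l
    using that move_move[of k l n] by (auto simp: move_def)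
  have undo_iff: "1 \<le> n k \<and> n' = move k l n \<longleftrightarrow> 1 \<le> n' l \<and> n = move l k n'" if "k \<noteq> l"
    for n n' :: "'s \<Rightarrow> nat" and k l
    using undo[OF that] undo[OF that[symmetric]] by blast
  have A: "weight \<gamma> (y, n) * A y n (y', n') k l = weight \<gamma> (y', n') * A y' n' (y, n) l k"
    if "k \<noteq> l" for k l
  proof (cases "1 \<le> n k \<and> n' = move k l n \<and> y' = y")
    case True
    then have "A y n (y', n') k l = task_rate \<gamma> \<beta> \<theta> \<epsilon> y n k l"
      by (simp add: A_def)
    moreover have "A y' n' (y, n) l k = task_rate \<gamma> \<beta> \<theta> \<epsilon> y n' l k"
      using undo_iff[OF that, of n n'] True unfolding A_def by (intro if_P[THEN trans]) auto
    ultimately show ?thesis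
      using task_balance[OF s[unfolded eq] that] True by simp
  next
    case False
    have "\<not> (1 \<le> n k \<and> (y', n') = (y, move k l n))"
      using False by (simp only: prod.inject) blast
    moreover have "\<not> (1 \<le> n' l \<and> (y, n) = (y', move l k n'))"
      using False undo_iff[OF that, of n n'] by (simp only: prod.inject) blast
    ultimately show ?thesis
      by (simp only: A_def if_False mult_zero_right)
  qed
  have B: "weight \<gamma> (y, n) * B y n (y', n') k l = weight \<gamma> (y', n') * B y' n' (y, n) l k"
    if "k \<noteq> l" for k l
  proof (cases "1 \<le> y k \<and> y' = move k l y \<and> n' = n")
    case True
    then have "B y n (y', n') k l = customer_rate \<gamma> \<tau> y n k l"
      by (simp add: B_def)
    moreover have "B y' n' (y, n) l k = customer_rate \<gamma> \<tau> y' n l k"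
      using undo_iff[OF that, of y y'] True unfolding B_def by (intro if_P[THEN trans]) auto
    ultimately show ?thesis
      using customer_balance[OF s[unfolded eq] that] True by simp
  next
    case False
    have "\<not> (1 \<le> y k \<and> (y', n') = (move k l y, n))"
      using False by (simp only: prod.inject) blast
    moreover have "\<not> (1 \<le> y' l \<and> (y, n) = (move l k y', n'))"
      using False undo_iff[OF that, of y y'] by (simp only: prod.inject) blast
    ultimately show ?thesis
      by (simp only: B_def if_False mult_zero_right)
  qed
  have swap: "(\<Sum>k\<in>UNIV. \<Sum>l\<in>UNIV - {k}. f k l) = (\<Sum>k\<in>UNIV. \<Sum>l\<in>UNIV - {k}. f l k)"
    for f :: "'s \<Rightarrow> 's \<Rightarrow> real"
  proof -
    have "(\<Sum>k\<in>UNIV. \<Sum>l\<in>UNIV - {k}. f k l) = (\<Sum>k\<in>UNIV. \<Sum>l | l \<in> UNIV \<and> k \<noteq> l. f k l)"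
      by (intro sum.cong) auto
    also have "\<dots> = (\<Sum>l\<in>UNIV. \<Sum>k | k \<in> UNIV \<and> k \<noteq> l. f k l)"
      by (rule sum.swap_restrict) auto
    also have "\<dots> = (\<Sum>k\<in>UNIV. \<Sum>l\<in>UNIV - {k}. f l k)"
      by (intro sum.cong) auto
    finally show ?thesis .
  qed
  have rate: "rate \<gamma> \<beta> \<theta> \<epsilon> \<tau> (y, n) s' =
      (\<Sum>k\<in>UNIV. \<Sum>l\<in>UNIV - {k}. A y n s' k l) + (\<Sum>k\<in>UNIV. \<Sum>l\<in>UNIV - {k}. B y n s' k l)" for y n s'
    by (simp add: rate_def A_def B_def)
  have "weight \<gamma> (y, n) * rate \<gamma> \<beta> \<theta> \<epsilon> \<tau> (y, n) (y', n') =
      (\<Sum>k\<in>UNIV. \<Sum>l\<in>UNIV - {k}. weight \<gamma> (y, n) * A y n (y', n') k l) +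
      (\<Sum>k\<in>UNIV. \<Sum>l\<in>UNIV - {k}. weight \<gamma> (y, n) * B y n (y', n') k l)"
    by (simp only: rate distrib_left sum_distrib_left)
  also have "\<dots> = (\<Sum>k\<in>UNIV. \<Sum>l\<in>UNIV - {k}. weight \<gamma> (y', n') * A y' n' (y, n) l k) +
      (\<Sum>k\<in>UNIV. \<Sum>l\<in>UNIV - {k}. weight \<gamma> (y', n') * B y' n' (y, n) l k)"
    by (intro arg_cong2[of _ _ _ _ "(+)"] sum.cong refl A B) auto
  also have "\<dots> = weight \<gamma> (y', n') * rate \<gamma> \<beta> \<theta> \<epsilon> \<tau> (y', n') (y, n)"
    unfolding swap[of "\<lambda>k l. weight \<gamma> (y', n') * A y' n' (y, n) l k"]
      swap[of "\<lambda>k l. weight \<gamma> (y', n') * B y' n' (y, n) l k"]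
    by (simp only: rate distrib_left sum_distrib_left)
  finally show ?thesis
    by (simp add: eq)
qed

lemma rate_move_pos:
  assumes s: "(y, n) \<in> states M N" and kl: "k \<noteq> l"
  shows "1 \<le> n k \<Longrightarrow> 0 < rate \<gamma> \<beta> \<theta> \<epsilon> \<tau> (y, n) (y, move k l n)"
    and "1 \<le> y k \<Longrightarrow> 0 < rate \<gamma> \<beta> \<theta> \<epsilon> \<tau> (y, n) (move k l y, n)"
proof -
  define A where "A s' k l =
    (if 1 \<le> n k \<and> s' = (y, move k l n) then task_rate \<gamma> \<beta> \<theta> \<epsilon> y n k l else 0)" for s' k l
  define B where "B s' k l =
    (if 1 \<le> y k \<and> s' = (move k l y, n) then customer_rate \<gamma> \<tau> y n k l else 0)" for s' k l
  have nonneg: "0 \<le> A s' i j" "0 \<le> B s' i j" if "j \<in> UNIV - {i}" for s' i j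
    using task_rate_pos[OF s, of i j] customer_rate_pos[OF s, of j i] that
    by (auto simp: A_def B_def order.strict_implies_order)
  have pos: "0 < (\<Sum>i\<in>UNIV. \<Sum>j\<in>UNIV - {i}. f i j)"
    if "\<And>i j. j \<in> UNIV - {i} \<Longrightarrow> 0 \<le> f i j" "0 < f k l" for f :: "'s \<Rightarrow> 's \<Rightarrow> real"
  proof (rule sum_pos2[of UNIV k])
    show "0 < (\<Sum>j\<in>UNIV - {k}. f k j)"
      by (rule sum_pos2[of _ l]) (use kl that in auto)
  qed (auto intro!: sum_nonneg that(1))
  have rate: "rate \<gamma> \<beta> \<theta> \<epsilon> \<tau> (y, n) s' =
      (\<Sum>k\<in>UNIV. \<Sum>l\<in>UNIV - {k}. A s' k l) + (\<Sum>k\<in>UNIV. \<Sum>l\<in>UNIV - {k}. B s' k l)" for s'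
    by (simp add: rate_def A_def B_def)
  show "0 < rate \<gamma> \<beta> \<theta> \<epsilon> \<tau> (y, n) (y, move k l n)" if "1 \<le> n k"
    unfolding rate using that task_rate_pos[OF s kl]
    by (intro add_pos_nonneg pos sum_nonneg nonneg) (auto simp: A_def)
  show "0 < rate \<gamma> \<beta> \<theta> \<epsilon> \<tau> (y, n) (move k l y, n)" if "1 \<le> y k"
    unfolding rate using that customer_rate_pos[OF s kl[symmetric]]
    by (intro add_nonneg_pos pos sum_nonneg nonneg) (auto simp: B_def)
qed

section \<open>Irreducibility and the normalized equilibrium\<close>

abbreviation Q :: "'s state \<Rightarrow> 's state \<Rightarrow> real" where
  "Q \<equiv> network_generator M N \<gamma> \<beta> \<theta> \<epsilon> \<tau>"

text \<open>Tasks are moved with the customers frozen, then customers with the tasks frozen. The two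
  totals are fixed separately, so the intermediate state \<open>(y, n')\<close> is
  admissible.\<close>

lemma irreducible:
  assumes "s \<in> states M N" "s' \<in> states M N"
  shows "(s, s') \<in> {(s, s'). s \<in> states M N \<and> s' \<in> states M N \<and> s \<noteq> s' \<and> 0 < Q s s'}\<^sup>*"
    (is "_ \<in> ?R\<^sup>*")
proof -
  obtain y n y' n' where eq: "s = (y, n)" "s' = (y', n')"
    by (metis surj_pair)
  have "((y, n), (y, n')) \<in> ?R\<^sup>*"
  proof (rule move_connected)
    fix m :: "'s \<Rightarrow> nat" and k l assume m: "(\<Sum>s\<in>UNIV. m s) = (\<Sum>s\<in>UNIV. n' s)" and kl: "k \<noteq> l" "1 \<le> m k"
    have "(y, m) \<in> states M N"
      using assms eq m by (simp add: states_def)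
    then show "((y, m), (y, move k l m)) \<in> ?R"
      using kl move_task_states[of y m M N k l] rate_move_pos(1)[of y m k l] move_neq[OF kl(1), of m]
      by (auto simp: network_generator_def generator_of_rates_def)
  qed (use assms eq in \<open>simp add: states_def\<close>)
  also have "((y, n'), (y', n')) \<in> ?R\<^sup>*"
  proof (rule move_connected[where f = "\<lambda>y. (y, n')"])
    fix m :: "'s \<Rightarrow> nat" and k l assume m: "(\<Sum>s\<in>UNIV. m s) = (\<Sum>s\<in>UNIV. y' s)" and kl: "k \<noteq> l" "1 \<le> m k"
    have "(m, n') \<in> states M N"
      using assms eq m by (simp add: states_def)
    then show "((m, n'), (move k l m, n')) \<in> ?R"
      using kl move_customer_states[of m n' M N k l] rate_move_pos(2)[of m n' k l] move_neq[OF kl(1), of m]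
      by (auto simp: network_generator_def generator_of_rates_def)
  qed (use assms eq in \<open>simp add: states_def\<close>)
  finally show ?thesis
    by (simp add: eq)
qed

lemma generator_balance:
  assumes "s \<in> states M N" "s' \<in> states M N"
  shows "equilibrium M N \<gamma> s * Q s s' = equilibrium M N \<gamma> s' * Q s' s"
  using rate_balance[OF assms] assms
  by (auto simp: equilibrium_def network_generator_def generator_of_rates_def)

lemma partition_function_pos:
  assumes "finite (states M N :: 's state set)"
  shows "0 < partition_function M N \<gamma>"
  unfolding partition_function_def
  using assms states_nonempty weight_pos by (intro sum_pos) auto

lemma equilibrium_pos:
  assumes "finite (states M N :: 's state set)" "s \<in> states M N"
  shows "0 < equilibrium M N \<gamma> s"
  using partition_function_pos[OF assms(1)] weight_pos[OF assms(2)] assms(2)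
  by (simp add: equilibrium_def)

lemma sum_equilibrium:
  assumes "finite (states M N :: 's state set)"
  shows "(\<Sum>s\<in>states M N. equilibrium M N \<gamma> s) = 1"
proof -
  have "(\<Sum>s\<in>states M N. equilibrium M N \<gamma> s) =
      (\<Sum>s\<in>states M N. weight \<gamma> s) / partition_function M N \<gamma>"
    by (simp add: equilibrium_def sum_divide_distrib)
  then show ?thesis
    using partition_function_pos[OF assms] by (simp add: partition_function_def)
qed

end

theorem theorem5p3:
  fixes M N :: nat
    and \<gamma> :: "'s::finite \<Rightarrow> nat \<Rightarrow> real"
    and \<beta> \<theta> \<epsilon> :: "'s task_array"
    and \<tau> :: "'s customer_array"
    and \<Omega> :: "'w measure"
    and Pr :: "'s state \<Rightarrow> 'w measure"
    and X :: "real \<Rightarrow> 'w \<Rightarrow> 's state"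
  assumes gamma_nonneg: "\<And>i n. 0 \<le> \<gamma> i n"
    and gamma_0: "\<And>i. \<gamma> i 0 = 1"
    and gamma_pos: "\<And>i n. 0 < \<gamma> i (n + 1) \<Longrightarrow> 0 < \<gamma> i n"
    and gamma_bar_pos:
      "\<And>y n j. (y, n) \<in> states M N \<Longrightarrow> 1 \<le> y j \<Longrightarrow> 0 < gamma_bar \<gamma> j (n j)"
    and beta_pos:
      "\<And>y n k l. (y, n) \<in> states M N \<Longrightarrow> k \<noteq> l \<Longrightarrow> y k = 0 \<Longrightarrow> y l = 0 \<Longrightarrow>
         0 < \<beta> k l (n k) (n l) y"
    and theta_pos:
      "\<And>y n j k. (y, n) \<in> states M N \<Longrightarrow> 1 \<le> y j \<Longrightarrow> y k = 0 \<Longrightarrow>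
         0 < \<theta> j k (n j) (n k) y \<and> 0 < \<theta> k j (n k) (n j) y"
    and epsilon_pos:
      "\<And>y n i j. (y, n) \<in> states M N \<Longrightarrow> i \<noteq> j \<Longrightarrow> 1 \<le> y i \<Longrightarrow> 1 \<le> y j \<Longrightarrow>
         0 < \<epsilon> i j (n i) (n j) y"
    and tau_pos:
      "\<And>y n j j'. (y, n) \<in> states M N \<Longrightarrow> 1 \<le> y j \<Longrightarrow> j' \<noteq> j \<Longrightarrow> 0 < \<tau> j j' n y"
    and beta_sym:
      "\<And>y n k l. (y, n) \<in> states M N \<Longrightarrow> k \<noteq> l \<Longrightarrow> y k = 0 \<Longrightarrow> y l = 0 \<Longrightarrow> 1 \<le> n k \<Longrightarrow>
         \<beta> k l (n k) (n l) y = \<beta> l k (n l + 1) (n k - 1) y"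
    and theta_sym:
      "\<And>y n j k. (y, n) \<in> states M N \<Longrightarrow> 1 \<le> y j \<Longrightarrow> y k = 0 \<Longrightarrow> 1 \<le> n j \<Longrightarrow>
         \<theta> j k (n j) (n k) y = \<theta> k j (n k + 1) (n j - 1) y"
    and epsilon_sym:
      "\<And>y n i j. (y, n) \<in> states M N \<Longrightarrow> i \<noteq> j \<Longrightarrow> 1 \<le> y i \<Longrightarrow> 1 \<le> y j \<Longrightarrow> 1 \<le> n i \<Longrightarrow>
         \<epsilon> i j (n i) (n j) y * \<gamma> i (n i - 1) ^ y i = \<gamma> j (n j) ^ y j * \<epsilon> j i (n j + 1) (n i - 1) y"
    and tau_sym:
      "\<And>y n j j'. (y, n) \<in> states M N \<Longrightarrow> 1 \<le> y j \<Longrightarrow> j' \<noteq> j \<Longrightarrow>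
         \<tau> j j' n y = \<tau> j' j n (move j j' y)"
    and process:
      "markov_process \<Omega> (states M N) (network_generator M N \<gamma> \<beta> \<theta> \<epsilon> \<tau>) Pr X"
  shows "positive_recurrent (states M N) (network_generator M N \<gamma> \<beta> \<theta> \<epsilon> \<tau>) Pr X
    \<and> stationary_distribution (states M N) Pr X (equilibrium M N \<gamma>)
    \<and> (\<forall>\<mu>. stationary_distribution (states M N) Pr X \<mu> \<longrightarrow> \<mu> = equilibrium M N \<gamma>)
    \<and> reversible (states M N) Pr X (equilibrium M N \<gamma>)"
proof -
  interpret markov_process \<Omega> "states M N" "network_generator M N \<gamma> \<beta> \<theta> \<epsilon> \<tau>" Pr X
    by (rule process)
  interpret network M N \<gamma> \<beta> \<theta> \<epsilon> \<tau>
    by unfold_locales (fact gamma_nonneg gamma_bar_pos beta_pos theta_pos epsilon_pos tau_pos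
      beta_sym theta_sym epsilon_sym tau_sym)+
  let ?S = "states M N :: 's state set" and ?\<pi> = "equilibrium M N \<gamma>"
  obtain h where h: "0 < h" "\<And>s s'. s \<in> ?S \<Longrightarrow> s' \<in> ?S \<Longrightarrow> 0 < P h s s'"
    using P_positive[OF irreducible] by blast
  have balance: "?\<pi> s * P t s s' = ?\<pi> s' * P t s' s" if "0 \<le> t" "s \<in> ?S" "s' \<in> ?S" for t s s'
    by (rule P_detailed_balance[OF equilibrium_pos[OF finite_states] generator_balance that(2,3,1)])
  have invariant: "(\<Sum>s\<in>?S. ?\<pi> s * P t s s') = ?\<pi> s'" if "0 \<le> t" "s' \<in> ?S" for t s'
    by (rule stationary_if_reversible[OF balance[OF that(1)] that])
  have nonneg: "0 \<le> ?\<pi> s" for s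
    using equilibrium_pos[OF finite_states, of s] by (cases "s \<in> ?S") (auto simp: equilibrium_def)
  have stationary: "stationary_distribution ?S Pr X ?\<pi>"
    unfolding stationary_distribution_def
    using nonneg invariant sum_equilibrium[OF finite_states] by (auto simp: equilibrium_def)
  have "positive_recurrent ?S Q Pr X"
    unfolding positive_recurrent_def
  proof
    fix s assume s: "s \<in> ?S"
    show "Q s s = 0 \<or> (\<integral>\<^sup>+ \<omega>. return_time X s \<omega> \<partial>Pr s) < \<infinity>"
    proof (cases "?S = {s}")
      \<comment> \<open>This happens with one site or with M = N = 0; the state is
        absorbing.\<close>
      case True
      then have "Q s s = 0"
        by (simp add: network_generator_def generator_of_rates_def)
      then show ?thesis ..
    next
      \<comment> \<open>Any other state can serve as the \<open>a\<close> that a path must visit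
        before its return.\<close>
      case False
      then obtain a where "a \<in> ?S" "a \<noteq> s"
        using s by blast
      then show ?thesis
        using finite_mean_return_time[OF h s] by blast
    qed
  qed
  moreover have "\<forall>\<mu>. stationary_distribution ?S Pr X \<mu> \<longrightarrow> \<mu> = ?\<pi>"
    using stationary_distribution_unique[OF h equilibrium_pos[OF finite_states] stationary] by blast
  moreover have "reversible ?S Pr X ?\<pi>"
    by (rule reversible_if_detailed_balance[OF balance invariant])
  ultimately show ?thesis
    using stationary by blast
qed

end
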